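(* Consider a control-affine system $\dot x(t)=X_0(x(t))+\sum_{i=1}^mu_i(t)X_i(x(t))$, $u\in\mathcal{U}$, on a smooth manifold $M$, with $X_0,\ldots,X_m$ smooth vector fields on $M$, and let $x\in M$. (i) For all $y\in\mathbf{C}^c(x)$ and all $u\in\mathcal{U}$ it follows that $\varphi(t,y,u)\in\mathbf{C}^c(x)$ for all $t<0$. Furthermore, for every $y\in\mathbf{C}^c(x)$ there exists $u\in\mathcal{U}$ such that $\varphi(t,y,u)\in\mathbf{C}^c(x)$ for all $t>0$. (ii) For all $y\in\mathbf{R}^c(x)$ and all $v\in\mathcal{U}$ it follows that $\varphi(t,y,v)\in\mathbf{R}^c(x)$ for all $t>0$. Furthermore, for every $y\in\mathbf{R}^c(x)$ there exists $v\in\mathcal{U}$ such that $\varphi(t,y,v)\in\mathbf{R}^c(x)$ for all $t<0$. (iii) Let $E$ be a chain control set. Then for all $x\in E$ it follows that $E=\mathbf{R}^c(x)\cap\mathbf{C}^c(x)$ and that there exists $u\in\mathcal{U}$ such that $\varphi(t,x,u)\in E$ for all $t\in\mathbb{R}$.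
   Context: $U\subset\mathbb{R}^m$ is a compact and convex neighborhood of $0$ and $\mathcal{U}=\{u\in L^\infty(\mathbb{R},\mathbb{R}^m): u(t)\in U \text{ for a.a. } t\in\mathbb{R}\}$. It is assumed that for every $u\in\mathcal{U}$ and every initial state $x(0)=x_0\in M$ there is a unique (Carathéodory) solution $\varphi(t,x_0,u)$ defined for all $t\in\mathbb{R}$. A metric $d$ on $M$ (inducing its topology) is fixed. For $\varepsilon,T>0$, a controlled $(\varepsilon,T)$-chain from $x$ to $y$ is given by $k\in\mathbb{N}$, points $x_0=x,x_1,\ldots,x_k=y\in M$, controls $u_0,\ldots,u_{k-1}\in\mathcal{U}$ and times $t_0,\ldots,t_{k-1}\ge T$ with $d(\varphi(t_j,x_j,u_j),x_{j+1})<\varepsilon$ for all $j=0,\ldots,k-1$. The point $x$ is chain controllable to $y$ if for all $\varepsilon,T>0$ there is a controlled $(\varepsilon,T)$-chain from $x$ to $y$. Put $\mathbf{R}^c(x)=\{y\in M: x\text{ is chain controllable to }y\}$ and $\mathbf{C}^c(x)=\{y\in M: y\text{ is chain controllable to }x\}$. A chain control set is a nonvoid set $E\subset M$ such that $x$ is chain controllable to $y$ for all $x,y\in E$, and $E$ is maximal (with respect to inclusion) with this property. *)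

theory Defs
  imports "HOL-Analysis.Analysis"
begin

section \<open>Smooth maps on open subsets of Euclidean spaces\<close>

(* C^k on an open set S: all iterated directional derivatives up to order k exist as Frechet
   derivatives and those of order k are continuous. *)
primrec Ck_on :: "nat \<Rightarrow> 'e::euclidean_space set \<Rightarrow> ('e \<Rightarrow> 'f::euclidean_space) \<Rightarrow> bool" where
  "Ck_on 0 S f \<longleftrightarrow> continuous_on S f"
| "Ck_on (Suc k) S f \<longleftrightarrow>
     (\<forall>z\<in>S. f differentiable (at z)) \<and> (\<forall>v. Ck_on k S (\<lambda>z. frechet_derivative f (at z) v))"

definition smooth_on :: "'e::euclidean_space set \<Rightarrow> ('e \<Rightarrow> 'f::euclidean_space) \<Rightarrow> bool" where
  "smooth_on S f \<longleftrightarrow> (\<forall>k. Ck_on k S f)"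


section \<open>Smooth manifolds and vector fields\<close>

(* A chart is given by its domain and its coordinate map; values of the coordinate map outside
   the domain are irrelevant. The manifold M is the whole type 'a. *)
type_synonym ('a, 'e) chart = "'a set \<times> ('a \<Rightarrow> 'e)"

abbreviation chart_dom :: "('a, 'e) chart \<Rightarrow> 'a set" where
  "chart_dom c \<equiv> fst c"

abbreviation chart_map :: "('a, 'e) chart \<Rightarrow> 'a \<Rightarrow> 'e" where
  "chart_map c \<equiv> snd c"

definition chart_inv :: "('a, 'e) chart \<Rightarrow> 'e \<Rightarrow> 'a" where
  "chart_inv c = inv_into (chart_dom c) (chart_map c)"

definition is_chart :: "('a::topological_space, 'e::euclidean_space) chart \<Rightarrow> bool" where
  "is_chart c \<longleftrightarrow>
     open (chart_dom c) \<and> open (chart_map c ` chart_dom c) \<and>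
     homeomorphism (chart_dom c) (chart_map c ` chart_dom c) (chart_map c) (chart_inv c)"

definition transition :: "('a, 'e) chart \<Rightarrow> ('a, 'e) chart \<Rightarrow> 'e \<Rightarrow> 'e" where
  "transition c c' = chart_map c' \<circ> chart_inv c"

(* The Hausdorff and countability requirements on M are carried by the type classes used in the
   theorem. *)
definition smooth_atlas :: "('a::topological_space, 'e::euclidean_space) chart set \<Rightarrow> bool" where
  "smooth_atlas A \<longleftrightarrow>
     (\<forall>c\<in>A. is_chart c) \<and> (\<Union>c\<in>A. chart_dom c) = UNIV \<and>
     (\<forall>c\<in>A. \<forall>c'\<in>A. smooth_on (chart_map c ` (chart_dom c \<inter> chart_dom c')) (transition c c'))"

(* A tangent vector at p is the family of its coordinate representations, one for each chart
   around p, related by the Jacobians of the transition maps. The value 0 for the remaining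
   charts is a normalization. Addition and scaling are pointwise in the chart. *)
type_synonym ('a, 'e) tangent_vector = "('a, 'e) chart \<Rightarrow> 'e"

definition tangent_space ::
  "('a, 'e::euclidean_space) chart set \<Rightarrow> 'a \<Rightarrow> ('a, 'e) tangent_vector set" where
  "tangent_space A p =
     {v. (\<forall>c\<in>A. \<forall>c'\<in>A. p \<in> chart_dom c \<inter> chart_dom c' \<longrightarrow>
            v c' = frechet_derivative (transition c c') (at (chart_map c p)) (v c)) \<and>
         (\<forall>c. \<not> (c \<in> A \<and> p \<in> chart_dom c) \<longrightarrow> v c = 0)}"

type_synonym ('a, 'e) vector_field = "'a \<Rightarrow> ('a, 'e) tangent_vector"

definition smooth_vector_field ::
  "('a, 'e::euclidean_space) chart set \<Rightarrow> ('a, 'e) vector_field \<Rightarrow> bool" where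
  "smooth_vector_field A X \<longleftrightarrow>
     (\<forall>p. X p \<in> tangent_space A p) \<and>
     (\<forall>c\<in>A. smooth_on (chart_map c ` chart_dom c) (\<lambda>z. X (chart_inv c z) c))"


section \<open>Control-affine systems and their solutions\<close>

(* Elements of L-infinity are represented by functions; nothing below depends on the
   representative. *)
definition L_infinity :: "(real \<Rightarrow> real ^ 'm) set" where
  "L_infinity = {u \<in> borel_measurable lebesgue. \<exists>C. AE t in lebesgue. norm (u t) \<le> C}"

definition admissible_controls :: "(real ^ 'm) set \<Rightarrow> (real \<Rightarrow> real ^ 'm) set" where
  "admissible_controls U = {u \<in> L_infinity. AE t in lebesgue. u t \<in> U}"

(* The division D is a finite family of nonoverlapping compact intervals. *)
definition absolutely_continuous_on_interval ::
  "real \<Rightarrow> real \<Rightarrow> (real \<Rightarrow> 'e::euclidean_space) \<Rightarrow> bool" where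
  "absolutely_continuous_on_interval a b f \<longleftrightarrow>
     (\<forall>\<epsilon>>0. \<exists>\<delta>>0. \<forall>D. D division_of \<Union>D \<and> \<Union>D \<subseteq> {a..b} \<and> (\<Sum>K\<in>D. Sup K - Inf K) < \<delta> \<longrightarrow>
        (\<Sum>K\<in>D. norm (f (Sup K) - f (Inf K))) < \<epsilon>)"

definition control_affine_field ::
  "('a, 'e::euclidean_space) vector_field \<Rightarrow> ('m::finite \<Rightarrow> ('a, 'e) vector_field) \<Rightarrow>
   real ^ 'm \<Rightarrow> ('a, 'e) vector_field" where
  "control_affine_field X\<^sub>0 X w = (\<lambda>p c. X\<^sub>0 p c + (\<Sum>i\<in>UNIV. (w $ i) *\<^sub>R X i p c))"

(* Caratheodory solutions on the whole real line: locally absolutely continuous curves (tested in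
   charts) satisfying the differential equation almost everywhere. *)
definition caratheodory_solution ::
  "('a::topological_space, 'e::euclidean_space) chart set \<Rightarrow> ('a, 'e) vector_field \<Rightarrow>
   ('m::finite \<Rightarrow> ('a, 'e) vector_field) \<Rightarrow> (real \<Rightarrow> real ^ 'm) \<Rightarrow> (real \<Rightarrow> 'a) \<Rightarrow> bool" where
  "caratheodory_solution A X\<^sub>0 X u \<xi> \<longleftrightarrow>
     continuous_on UNIV \<xi> \<and>
     (\<forall>c\<in>A. \<forall>a b. \<xi> ` {a..b} \<subseteq> chart_dom c \<longrightarrow>
        absolutely_continuous_on_interval a b (chart_map c \<circ> \<xi>)) \<and>
     (\<forall>c\<in>A. AE t in lebesgue. \<xi> t \<in> chart_dom c \<longrightarrow>
        ((chart_map c \<circ> \<xi>) has_vector_derivative control_affine_field X\<^sub>0 X (u t) (\<xi> t) c) (at t))"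

definition unique_global_solutions ::
  "('a::topological_space, 'e::euclidean_space) chart set \<Rightarrow> ('a, 'e) vector_field \<Rightarrow>
   ('m::finite \<Rightarrow> ('a, 'e) vector_field) \<Rightarrow> (real ^ 'm) set \<Rightarrow> bool" where
  "unique_global_solutions A X\<^sub>0 X U \<longleftrightarrow>
     (\<forall>u\<in>admissible_controls U. \<forall>x. \<exists>!\<xi>. caratheodory_solution A X\<^sub>0 X u \<xi> \<and> \<xi> 0 = x)"

definition solution_map ::
  "('a::topological_space, 'e::euclidean_space) chart set \<Rightarrow> ('a, 'e) vector_field \<Rightarrow>
   ('m::finite \<Rightarrow> ('a, 'e) vector_field) \<Rightarrow> real \<Rightarrow> 'a \<Rightarrow> (real \<Rightarrow> real ^ 'm) \<Rightarrow> 'a" where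
  "solution_map A X\<^sub>0 X t x u = (THE \<xi>. caratheodory_solution A X\<^sub>0 X u \<xi> \<and> \<xi> 0 = x) t"


section \<open>Chain controllability\<close>

(* Here \<phi> is a solution map and \<U> a set of controls. Chains have at least one segment, so a
   point is not automatically chain controllable to itself. *)
definition controlled_chain ::
  "(real \<Rightarrow> 'a::metric_space \<Rightarrow> 'u \<Rightarrow> 'a) \<Rightarrow> 'u set \<Rightarrow> real \<Rightarrow> real \<Rightarrow> 'a \<Rightarrow> 'a \<Rightarrow> bool" where
  "controlled_chain \<phi> \<U> \<epsilon> T x y \<longleftrightarrow>
     (\<exists>k\<ge>1. \<exists>(xs :: nat \<Rightarrow> 'a) us ts. xs 0 = x \<and> xs k = y \<and>
        (\<forall>j<k. us j \<in> \<U> \<and> ts j \<ge> T \<and> dist (\<phi> (ts j) (xs j) (us j)) (xs (Suc j)) < \<epsilon>))"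

definition chain_controllable ::
  "(real \<Rightarrow> 'a::metric_space \<Rightarrow> 'u \<Rightarrow> 'a) \<Rightarrow> 'u set \<Rightarrow> 'a \<Rightarrow> 'a \<Rightarrow> bool" where
  "chain_controllable \<phi> \<U> x y \<longleftrightarrow> (\<forall>\<epsilon>>0. \<forall>T>0. controlled_chain \<phi> \<U> \<epsilon> T x y)"

definition chain_reachable_set ::
  "(real \<Rightarrow> 'a::metric_space \<Rightarrow> 'u \<Rightarrow> 'a) \<Rightarrow> 'u set \<Rightarrow> 'a \<Rightarrow> 'a set" where
  "chain_reachable_set \<phi> \<U> x = {y. chain_controllable \<phi> \<U> x y}"

definition chain_controllable_set ::
  "(real \<Rightarrow> 'a::metric_space \<Rightarrow> 'u \<Rightarrow> 'a) \<Rightarrow> 'u set \<Rightarrow> 'a \<Rightarrow> 'a set" where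
  "chain_controllable_set \<phi> \<U> x = {y. chain_controllable \<phi> \<U> y x}"

definition chain_control_set ::
  "(real \<Rightarrow> 'a::metric_space \<Rightarrow> 'u \<Rightarrow> 'a) \<Rightarrow> 'u set \<Rightarrow> 'a set \<Rightarrow> bool" where
  "chain_control_set \<phi> \<U> E \<longleftrightarrow>
     E \<noteq> {} \<and> (\<forall>x\<in>E. \<forall>y\<in>E. chain_controllable \<phi> \<U> x y) \<and>
     (\<forall>F. E \<subseteq> F \<and> (\<forall>x\<in>F. \<forall>y\<in>F. chain_controllable \<phi> \<U> x y) \<longrightarrow> F = E)"

end

theory Submission
  imports Defs "HOL-Complex_Analysis.Great_Picard"
begin

text \<open>
  The statement about chains uses only five properties of the solution map \<open>\<phi>\<close>: \<open>\<phi> 0\<close> is the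
  identity, controls may be translated in time and concatenated, \<open>\<phi>\<close> is continuous in the initial
  state, and (the substantial one) sequential compactness: if \<open>q\<^sub>n \<rightarrow> y\<close>, then along a
  subsequence \<open>\<phi>(t, q\<^sub>n, u\<^sub>n) \<rightarrow> \<phi>(t, y, u)\<close> for one control \<open>u\<close> and all times \<open>t\<close> simultaneously.
  They form the locale \<open>control_flow\<close>.

  Given these, the universal invariance claims prolong the first or last segment of a chain by the
  given piece of trajectory. For the existential claims, take for each \<open>n\<close> a chain with jumps below
  \<open>1/(n+1)\<close> and times at least \<open>n+1\<close>, and let \<open>u\<close> be a limit of the controls on the first segments (for
  backward orbits: the last ones, with time counted from their endpoints). A point of the orbit of
  \<open>u\<close> can follow \<open>u\<close>, jump onto an approximating long segment and continue along the rest of that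
  chain (backwards: be reached by jumping off such a segment); the
  segments are so long that cutting off a bounded piece still leaves the required time. A point
  \<open>z\<close> of a chain control set \<open>E\<close> is chain controllable to itself, so it has a forward orbit and a
  backward orbit of these kinds; concatenated at time 0 they stay in
  \<open>\<^bold>R\<^sup>c(z) \<inter> \<^bold>C\<^sup>c(z) = E\<close>.

  Compactness of the flow has two ingredients. First, \<open>U\<close>-valued controls are weakly
  sequentially compact (\<open>weak_sequential_compactness\<close>): after passing to a subsequence all
  integrals over intervals converge, and the limit control is an almost everywhere limit of midpoint
  combinations of the sequence, obtained by minimizing an \<open>L\<^sup>2\<close> energy; since \<open>U\<close> is closed and
  convex the limit is \<open>U\<close>-valued, and its integrals are the right ones by dominated convergence.
  Second, weak convergence of controls and convergence of initial states give convergence of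
  solutions (\<open>solutions_converge\<close>). The solution for the limit control exists by assumption, so it
  only has to be compared with the others. In a chart both are integrals of their
  velocities, and as the control enters affinely the velocities differ by a Lipschitz term and a term
  \<open>(u\<^sub>n - u)\<^sub>i X\<^sub>i\<close> along the fixed limit solution, whose integral tends to 0. On short time
  intervals the Lipschitz term is absorbed; hence the set of times at which the
  solutions converge is open and closed in the real line.
\<close>

section \<open>Integrals of derivatives of absolutely continuous functions\<close>

text \<open>
  The members of a division overlap only in their boundaries, so their lengths add up to the
  measure of the union.
\<close>
lemma sum_content_division_le_measure:
  fixes D :: "'a::euclidean_space set set"
  assumes D: "D division_of \<Union>D" and sub: "\<Union>D \<subseteq> G" and G: "G \<in> lmeasurable"
  shows "(\<Sum>K\<in>D. measure lborel K) \<le> measure lebesgue G"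
proof -
  have cb: "\<exists>a b. K = cbox a b" if "K \<in> D" for K
    using D that by (meson division_ofD(4))
  have "(\<Sum>K\<in>D. measure lborel K) = (\<Sum>K\<in>D. measure lebesgue K)"
  proof (intro sum.cong refl)
    fix K assume "K \<in> D"
    then obtain a b where "K = cbox a b" using cb by blast
    then show "measure lborel K = measure lebesgue K"
      by (simp add: measure_completion)
  qed
  also have "\<dots> = measure lebesgue (\<Union>D)"
  proof (rule measure_negligible_finite_Union[symmetric])
    show "finite D" using D by auto
    show "K \<in> lmeasurable" if "K \<in> D" for K
      using cb[OF that] by auto
    show "pairwise (\<lambda>K L. negligible (K \<inter> L)) D"
    proof (rule pairwiseI)
      fix K L assume KL: "K \<in> D" "L \<in> D" "K \<noteq> L"
      obtain a b c d where e: "K = cbox a b" "L = cbox c d"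
        using cb KL by meson
      have "interior K \<inter> interior L = {}"
        using division_ofD(5)[OF D] KL by blast
      then have "K \<inter> L \<subseteq> (cbox a b - box a b) \<union> (cbox c d - box c d)"
        using e by auto
      then show "negligible (K \<inter> L)"
        by (meson negligible_Un negligible_frontier_interval negligible_subset)
    qed
  qed
  also have "\<dots> \<le> measure lebesgue G"
  proof (rule measure_mono_fmeasurable[OF sub _ G])
    show "\<Union>D \<in> sets lebesgue"
      using D cb by (metis lmeasurable_division fmeasurableD)
  qed
  finally show ?thesis .
qed

text \<open>
  Subtracting the linearizations at the two endpoints lets the interval straddle the point of
  differentiability, which is what a tagged interval of a gauge integral does.
\<close>
lemma derivative_straddle:
  fixes f :: "real \<Rightarrow> 'e::real_normed_vector"
  assumes "(f has_vector_derivative D) (at x)" "0 < e"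
  obtains d where "0 < d"
    "\<And>u v. \<lbrakk>u \<le> x; x \<le> v; \<bar>u - x\<bar> < d; \<bar>v - x\<bar> < d\<rbrakk> \<Longrightarrow> norm ((v - u) *\<^sub>R D - (f v - f u)) \<le> e * (v - u)"
proof -
  obtain d where d: "0 < d" "\<And>y. \<bar>y - x\<bar> < d \<Longrightarrow> norm (f y - f x - (y - x) *\<^sub>R D) \<le> e * \<bar>y - x\<bar>"
    using assms unfolding has_vector_derivative_def has_derivative_at_alt by fastforce
  show thesis
  proof (rule that[OF d(1)])
    fix u v assume uv: "u \<le> x" "x \<le> v" "\<bar>u - x\<bar> < d" "\<bar>v - x\<bar> < d"
    have "norm ((v - u) *\<^sub>R D - (f v - f u))
        = norm ((f u - f x - (u - x) *\<^sub>R D) - (f v - f x - (v - x) *\<^sub>R D))"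
      by (simp add: algebra_simps)
    also have "\<dots> \<le> e * \<bar>u - x\<bar> + e * \<bar>v - x\<bar>"
      by (rule norm_triangle_le_diff) (intro add_mono d uv)
    also have "\<dots> = e * (v - u)"
      using uv by (simp add: algebra_simps)
    finally show "norm ((v - u) *\<^sub>R D - (f v - f u)) \<le> e * (v - u)" .
  qed
qed

text \<open>
  Two tags can share an interval only if its interior is empty, and on the line such an interval
  is the single point that is its tag. Sums over tagged intervals can therefore be rewritten as
  sums over intervals, the form in which absolute continuity is given.
\<close>
lemma inj_on_snd_tagged_partial_division:
  fixes p :: "(real \<times> real set) set"
  assumes "p tagged_partial_division_of S"
  shows "inj_on snd p"
proof (rule inj_onI)
  fix s t assume st: "s \<in> p" "t \<in> p" "snd s = snd t"
  obtain x y K where e: "s = (x, K)" "t = (y, K)"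
    using st(3) by (metis prod.collapse)
  obtain a b where K: "K = cbox a b"
    using tagged_partial_division_ofD(4)[OF assms] st e by blast
  have xy: "x \<in> K" "y \<in> K"
    using tagged_partial_division_ofD(2)[OF assms] st e by blast+
  have "x = y"
  proof (rule ccontr)
    assume "x \<noteq> y"
    then have "interior K = {}"
      using tagged_partial_division_ofD(5)[OF assms, of x K y K] st e by auto
    then show False
      using xy K \<open>x \<noteq> y\<close> by (auto simp: interior_cbox)
  qed
  then show "s = t" by (simp add: e)
qed

text \<open>
  A gauge argument. Intervals tagged outside the exceptional null set are controlled by
  differentiability at the tag. The gauge confines those tagged inside it to an open set of
  small measure, and absolute continuity bounds the sum of their increments.
\<close>
lemma absolutely_continuous_has_integral_derivative:
  fixes f :: "real \<Rightarrow> 'e::euclidean_space"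
  assumes ab: "a \<le> b" and ac: "absolutely_continuous_on_interval a b f"
    and N: "negligible N"
    and der: "\<And>t. \<lbrakk>t \<in> {a..b}; t \<notin> N\<rbrakk> \<Longrightarrow> (f has_vector_derivative g t) (at t)"
  shows "(g has_integral (f b - f a)) {a..b}"
proof -
  \<comment> \<open>with value 0 on the null set, tags there contribute only increments of \<open>f\<close>\<close>
  define h where "h t = (if t \<in> N then 0 else g t)" for t
  have "(h has_integral (f b - f a)) (cbox a b)"
    unfolding has_integral
  proof (intro allI impI)
    fix e :: real assume e: "0 < e"
    define e1 where "e1 = e / (2 * (b - a + 1))"
    have e1: "0 < e1" "e1 * (b - a) < e / 2"
      using e ab by (auto simp: e1_def field_simps)
    obtain \<delta> where \<delta>: "0 < \<delta>"
      "\<And>D. \<lbrakk>D division_of \<Union>D; \<Union>D \<subseteq> {a..b}; (\<Sum>K\<in>D. Sup K - Inf K) < \<delta>\<rbrakk>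
         \<Longrightarrow> (\<Sum>K\<in>D. norm (f (Sup K) - f (Inf K))) < e / 2"
      using ac[unfolded absolutely_continuous_on_interval_def, rule_format, OF half_gt_zero[OF e]] by blast
    have Nn: "N \<in> null_sets lebesgue" using N by (simp add: negligible_iff_null_sets)
    then obtain G where G: "open G" "N \<subseteq> G" "G - N \<in> lmeasurable" "emeasure lebesgue (G - N) < ennreal \<delta>"
      using sets_lebesgue_outer_open[OF _ \<delta>(1), of N] by auto
    have Gm: "G \<in> lmeasurable"
      using G(2) fmeasurable.Un[OF G(3) negligible_imp_measurable[OF N]] by (simp add: Un_absorb2)
    have "emeasure lebesgue G = emeasure lebesgue (G - N)"
      using emeasure_Diff_null_set[OF Nn, of G] Gm by (simp add: fmeasurableD)
    then have "ennreal (measure lebesgue G) < ennreal \<delta>"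
      using G(4) emeasure_eq_measure2[OF Gm] by metis
    then have mG: "measure lebesgue G < \<delta>"
      by (simp add: ennreal_less_iff)
    have "\<exists>d>0. \<forall>u v. t \<in> {a..b} \<and> t \<notin> N \<and> u \<le> t \<and> t \<le> v \<and> \<bar>u - t\<bar> < d \<and> \<bar>v - t\<bar> < d \<longrightarrow>
        norm ((v - u) *\<^sub>R g t - (f v - f u)) \<le> e1 * (v - u)" for t
    proof (cases "t \<in> {a..b} \<and> t \<notin> N")
      case True
      then show ?thesis
        using derivative_straddle[OF der e1(1), of t] by metis
    qed (use zero_less_one in blast)
    then obtain d where d: "\<And>t. 0 < d t"
      "\<And>t u v. \<lbrakk>t \<in> {a..b}; t \<notin> N; u \<le> t; t \<le> v; \<bar>u - t\<bar> < d t; \<bar>v - t\<bar> < d t\<rbrakk> \<Longrightarrow>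
        norm ((v - u) *\<^sub>R g t - (f v - f u)) \<le> e1 * (v - u)"
      by metis
    define \<gamma> where "\<gamma> t = (if t \<in> N then G else ball t (d t))" for t
    have gauge: "gauge \<gamma>"
      using G d(1) by (auto simp: gauge_def \<gamma>_def)
    have "norm ((\<Sum>(x, K)\<in>p. measure lborel K *\<^sub>R h x) - (f b - f a)) < e"
      if p: "p tagged_division_of cbox a b" and fine: "\<gamma> fine p" for p
    proof -
      have ivl: "\<exists>u v. K = {u..v} \<and> u \<le> x \<and> x \<le> v \<and> a \<le> u \<and> v \<le> b" if xK: "(x, K) \<in> p" for x K
      proof -
        obtain u v where "K = cbox u v" using tagged_division_ofD(4)[OF p xK] by blast
        moreover have "x \<in> K" "K \<subseteq> cbox a b" using tagged_division_ofD(2,3)[OF p xK] by blast+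
        ultimately show ?thesis by auto
      qed
      have fin: "finite p" using p by auto
      define p1 where "p1 = {s \<in> p. fst s \<in> N}"
      have pU: "p = p1 \<union> (p - p1)" "p1 \<inter> (p - p1) = {}" and p1: "p1 \<subseteq> p"
        by (auto simp: p1_def)
      define r where "r s = (case s of (x, K) \<Rightarrow> measure lborel K *\<^sub>R h x - (f (Sup K) - f (Inf K)))" for s
      have "(\<Sum>(x, K)\<in>p. measure lborel K *\<^sub>R h x) - (f b - f a) = sum r p"
        using additive_tagged_division_1[OF ab, of p f] p
        by (simp add: r_def split_def sum_subtractf)
      also have "\<dots> = sum r p1 + sum r (p - p1)"
        using pU fin by (metis add.commute p1 sum.subset_diff)
      finally have eq: "(\<Sum>(x, K)\<in>p. measure lborel K *\<^sub>R h x) - (f b - f a) = sum r p1 + sum r (p - p1)" .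
      have p1p: "p1 tagged_partial_division_of cbox a b"
        using p p1 unfolding tagged_division_of_def by (meson tagged_partial_division_subset)
      have Ddiv: "snd ` p1 division_of \<Union>(snd ` p1)"
        by (rule partial_division_of_tagged_division[OF p1p])
      have inj: "inj_on snd p1" by (rule inj_on_snd_tagged_partial_division[OF p1p])
      have len: "Sup K - Inf K = measure lborel K" if "K \<in> snd ` p1" for K
        using ivl that p1 by fastforce
      have "(\<Sum>K\<in>snd ` p1. Sup K - Inf K) = (\<Sum>K\<in>snd ` p1. measure lborel K)"
        by (intro sum.cong refl len)
      also have "\<dots> \<le> measure lebesgue G"
      proof (rule sum_content_division_le_measure[OF Ddiv _ Gm])
        show "\<Union>(snd ` p1) \<subseteq> G"
          using fine by (force simp: fine_def p1_def \<gamma>_def)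
      qed
      finally have "(\<Sum>K\<in>snd ` p1. Sup K - Inf K) < \<delta>" using mG by simp
      moreover have "\<Union>(snd ` p1) \<subseteq> {a..b}"
        using ivl p1 by fastforce
      ultimately have "(\<Sum>K\<in>snd ` p1. norm (f (Sup K) - f (Inf K))) < e / 2"
        using \<delta>(2) Ddiv by blast
      moreover have "(\<Sum>K\<in>snd ` p1. norm (f (Sup K) - f (Inf K))) = (\<Sum>s\<in>p1. norm (r s))"
        unfolding sum.reindex[OF inj] o_def
        by (intro sum.cong) (auto simp: r_def p1_def h_def split_def norm_minus_commute)
      ultimately have n1: "norm (sum r p1) < e / 2"
        using norm_sum[of r p1] by linarith
      have "norm (sum r (p - p1)) \<le> (\<Sum>s\<in>p - p1. e1 * (Sup (snd s) - Inf (snd s)))"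
      proof (rule sum_norm_le)
        fix s assume s: "s \<in> p - p1"
        obtain x K where sK: "s = (x, K)" by force
        then have xK: "(x, K) \<in> p" "x \<notin> N" using s by (auto simp: p1_def)
        obtain u v where uv: "K = {u..v}" "u \<le> x" "x \<le> v" "a \<le> u" "v \<le> b" using ivl xK by blast
        have "K \<subseteq> \<gamma> x" using fine xK(1) by (auto simp: fine_def)
        then have "K \<subseteq> ball x (d x)" using xK(2) by (simp add: \<gamma>_def)
        moreover have "u \<in> K" "v \<in> K" using uv by auto
        ultimately have "u \<in> ball x (d x)" "v \<in> ball x (d x)" by blast+
        then have "\<bar>u - x\<bar> < d x" "\<bar>v - x\<bar> < d x"
          by (simp_all add: dist_real_def abs_minus_commute)
        then show "norm (r s) \<le> e1 * (Sup (snd s) - Inf (snd s))"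
          using d(2)[of x u v] uv xK by (simp add: sK r_def h_def)
      qed
      also have "\<dots> \<le> (\<Sum>s\<in>p. e1 * (Sup (snd s) - Inf (snd s)))"
      proof (rule sum_mono2[OF fin])
        fix s assume "s \<in> p - (p - p1)"
        then show "0 \<le> e1 * (Sup (snd s) - Inf (snd s))"
          using ivl[of "fst s" "snd s"] e1 by auto
      qed auto
      also have "\<dots> = e1 * (b - a)"
        using additive_tagged_division_1[OF ab, of p "\<lambda>x. x"] p
        by (simp add: split_def sum_distrib_left[symmetric])
      finally have n2: "norm (sum r (p - p1)) < e / 2" using e1 by linarith
      show ?thesis
        unfolding eq using norm_triangle_ineq[of "sum r p1" "sum r (p - p1)"] n1 n2 by linarith
    qed
    then show "\<exists>\<gamma>. gauge \<gamma> \<and> (\<forall>p. p tagged_division_of cbox a b \<and> \<gamma> fine p \<longrightarrow>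
        norm ((\<Sum>(x, K)\<in>p. measure lborel K *\<^sub>R h x) - (f b - f a)) < e)"
      using gauge by blast
  qed
  then have "(h has_integral (f b - f a)) {a..b}" by simp
  then show ?thesis
    by (rule has_integral_spike[OF N, rotated]) (auto simp: h_def)
qed

section \<open>Almost everywhere convergent midpoint combinations\<close>

lemma bounded_measurable_integrable:
  fixes w :: "real \<Rightarrow> 'v::euclidean_space"
  assumes "w \<in> borel_measurable lebesgue" "\<And>t. norm (w t) \<le> C"
  shows "w integrable_on {a..b}"
proof -
  have "w absolutely_integrable_on {a..b}"
    using assms(2) by (intro measurable_bounded_by_integrable_imp_absolutely_integrable[where g = "\<lambda>_. C"]
        measurable_restrict_space1[OF assms(1)]) auto
  then show ?thesis
    using set_lebesgue_integral_eq_integral(1) by blast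
qed

lemma norm_integral_le_length:
  fixes w :: "real \<Rightarrow> 'v::euclidean_space"
  assumes "w integrable_on {a..b}" "\<And>t. t \<in> {a..b} \<Longrightarrow> norm (w t) \<le> C" "a \<le> b"
  shows "norm (integral {a..b} w) \<le> C * (b - a)"
proof -
  have "0 \<le> C"
    by (rule order_trans[OF norm_ge_zero assms(2)[of a]]) (use assms(3) in auto)
  then show ?thesis
    using has_integral_bound_real[of C "{}" w "integral {a..b} w" a b] assms by (simp add: integrable_integral)
qed

text \<open>
  Diagonalization over intervals with rational endpoints; the integrals over all other intervals
  follow because the integrands are uniformly bounded. Dividing by \<open>1 + \<bar>q -
  p\<bar>\<close> makes the diagonalized family uniformly bounded.
\<close>
lemma subsequence_convergent_integrals:
  fixes u :: "nat \<Rightarrow> real \<Rightarrow> 'v::euclidean_space"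
  assumes meas: "\<And>n. u n \<in> borel_measurable lebesgue" and bd: "\<And>n t. norm (u n t) \<le> C"
  obtains r where "strict_mono (r :: nat \<Rightarrow> nat)"
    "\<And>a b. convergent (\<lambda>n. integral {a..b} (u (r n)))"
proof -
  have int: "u n integrable_on {a..b}" for n a b
    by (rule bounded_measurable_integrable[OF meas bd])
  have C0: "0 \<le> C" by (rule order_trans[OF norm_ge_zero bd[of 0 0]])
  define F where "F n = (\<lambda>(p, q). (1 / (1 + \<bar>q - p\<bar>)) *\<^sub>R integral {p..q} (u n))" for n
  have Fb: "norm (F n s) \<le> C" for n s
  proof -
    obtain p q where s: "s = (p, q)" by force
    have "norm (integral {p..q} (u n)) \<le> C * (1 + \<bar>q - p\<bar>)"
    proof (cases "p \<le> q")
      case True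
      then have "norm (integral {p..q} (u n)) \<le> C * (q - p)"
        by (intro norm_integral_le_length int bd)
      also have "\<dots> \<le> C * (1 + \<bar>q - p\<bar>)" using C0 True by (intro mult_left_mono) auto
      finally show ?thesis .
    qed (use C0 in auto)
    then show ?thesis
      by (simp add: F_def s divide_simps)
  qed
  obtain r :: "nat \<Rightarrow> nat" where r: "strict_mono r" "\<And>s. s \<in> \<rat> \<times> \<rat> \<Longrightarrow> \<exists>l. (\<lambda>n. F (r n) s) \<longlonglongrightarrow> l"
    by (rule function_convergent_subsequence[of "\<rat> \<times> \<rat>" F C]) (use Fb countable_rat in auto)
  have conv: "Cauchy (\<lambda>n. integral {p..q} (u (r n)))" if pq: "p \<in> \<rat>" "q \<in> \<rat>" for p q
  proof -
    obtain l where "(\<lambda>n. F (r n) (p, q)) \<longlonglongrightarrow> l" using r(2) pq by blast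
    then have "(\<lambda>n. (1 + \<bar>q - p\<bar>) *\<^sub>R F (r n) (p, q)) \<longlonglongrightarrow> (1 + \<bar>q - p\<bar>) *\<^sub>R l"
      by (intro tendsto_intros)
    moreover have "(1 + \<bar>q - p\<bar>) *\<^sub>R F (r n) (p, q) = integral {p..q} (u (r n))" for n
    proof -
      have "1 + \<bar>q - p\<bar> \<noteq> 0" by linarith
      then show ?thesis by (simp add: F_def)
    qed
    ultimately show ?thesis
      by (intro LIMSEQ_imp_Cauchy) simp
  qed
  have "convergent (\<lambda>n. integral {a..b} (u (r n)))" for a b
  proof (cases "a \<le> b")
    case True
    show ?thesis
      unfolding Cauchy_convergent_iff[symmetric]
    proof (rule metric_CauchyI)
      fix e :: real assume e: "0 < e"
      define h where "h = e / (6 * (C + 1))"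
      have h: "0 < h" "C * h \<le> e / 6" using e C0 by (auto simp: h_def field_simps)
      obtain p q where p: "p \<in> \<rat>" "a - h < p" "p < a" and q: "q \<in> \<rat>" "b < q" "q < b + h"
        by (metis Rats_dense_in_real diff_less_eq h(1) less_add_same_cancel1)
      have near: "norm (integral {p..q} (u n) - integral {a..b} (u n)) \<le> e / 3" for n
      proof -
        have "integral {p..q} (u n) = integral {p..a} (u n) + integral {a..q} (u n)"
          using p q True int by (intro Henstock_Kurzweil_Integration.integral_combine[symmetric]) auto
        moreover have "integral {a..q} (u n) = integral {a..b} (u n) + integral {b..q} (u n)"
          using p q True int by (intro Henstock_Kurzweil_Integration.integral_combine[symmetric]) auto
        moreover have "norm (integral {p..a} (u n)) \<le> C * (a - p)" "norm (integral {b..q} (u n)) \<le> C * (q - b)"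
          using p q by (auto intro!: norm_integral_le_length int bd)
        moreover have "C * (a - p) \<le> C * h" "C * (q - b) \<le> C * h"
          using p q C0 by (auto intro!: mult_left_mono)
        ultimately show ?thesis
          using h norm_triangle_ineq[of "integral {p..a} (u n)" "integral {b..q} (u n)"] by (simp add: algebra_simps)
      qed
      obtain N where N: "\<And>m n. \<lbrakk>m \<ge> N; n \<ge> N\<rbrakk> \<Longrightarrow>
          dist (integral {p..q} (u (r m))) (integral {p..q} (u (r n))) < e / 3"
        using metric_CauchyD[OF conv[OF p(1) q(1)], of "e / 3"] e by auto
      have "dist (integral {a..b} (u (r m))) (integral {a..b} (u (r n))) < e" if "m \<ge> N" "n \<ge> N" for m n
        using N[OF that] near[of "r m"] near[of "r n"] unfolding dist_norm
        by norm
      then show "\<exists>M. \<forall>m\<ge>M. \<forall>n\<ge>M. dist (integral {a..b} (u (r m))) (integral {a..b} (u (r n))) < e"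
        by blast
    qed
  qed (simp add: convergent_const)
  then show thesis using r(1) that by blast
qed

text \<open>
  The dyadic convex combinations of a family of functions. Midpoints suffice for the
  parallelogram argument below, and induction over this set transfers pointwise and integral
  properties of the generators.
\<close>
inductive_set midpoint_hull :: "('a \<Rightarrow> 'v::real_vector) set \<Rightarrow> ('a \<Rightarrow> 'v) set"
  for S where
  base: "f \<in> S \<Longrightarrow> f \<in> midpoint_hull S"
| midpoint: "\<lbrakk>f \<in> midpoint_hull S; g \<in> midpoint_hull S\<rbrakk> \<Longrightarrow> (\<lambda>t. (1/2) *\<^sub>R (f t + g t)) \<in> midpoint_hull S"

lemma midpoint_hull_mono: "S \<subseteq> T \<Longrightarrow> midpoint_hull S \<subseteq> midpoint_hull T"
proof
  fix f assume ST: "S \<subseteq> T" and "f \<in> midpoint_hull S"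
  from this(2) show "f \<in> midpoint_hull T"
    by induction (use ST in \<open>auto intro: midpoint_hull.intros\<close>)
qed

lemma midpoint_hull_bounded:
  assumes "f \<in> midpoint_hull S" "\<And>g. g \<in> S \<Longrightarrow> norm (g t) \<le> (C::real)"
  shows "norm (f t :: 'v::real_normed_vector) \<le> C"
  using assms(1)
proof induction
  case (midpoint f g)
  then show ?case
    using norm_triangle_ineq[of "f t" "g t"] by simp
qed (use assms in auto)

lemma midpoint_hull_measurable:
  fixes f :: "'a \<Rightarrow> 'v::euclidean_space"
  assumes "f \<in> midpoint_hull S" "S \<subseteq> borel_measurable M"
  shows "f \<in> borel_measurable M"
  using assms(1) by induction (use assms(2) in auto)

lemma midpoint_hull_convex:
  assumes "f \<in> midpoint_hull S" "convex U" "\<And>g. g \<in> S \<Longrightarrow> g t \<in> U"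
  shows "f t \<in> U"
  using assms(1)
proof induction
  case (midpoint f g)
  then show ?case
    using convexD[OF assms(2), of "f t" "g t" "1/2" "1/2"] by (simp add: scaleR_add_right)
qed (use assms in auto)

lemma AE_convergent_of_fast_L1_Cauchy:
  fixes h :: "nat \<Rightarrow> 'a \<Rightarrow> 'v::euclidean_space"
  assumes meas: "\<And>k. h k \<in> borel_measurable M"
    and B: "\<And>k. (\<integral>\<^sup>+t. ennreal (norm (h (Suc k) t - h k t)) \<partial>M) \<le> ennreal (B k)"
    and B0: "\<And>k. 0 \<le> B k" and sB: "summable B"
  shows "AE t in M. convergent (\<lambda>k. h k t)"
proof -
  have m: "(\<lambda>t. ennreal (norm (h (Suc k) t - h k t))) \<in> borel_measurable M" for k
    using meas by measurable
  have "(\<integral>\<^sup>+t. (\<Sum>k. ennreal (norm (h (Suc k) t - h k t))) \<partial>M)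
      = (\<Sum>k. \<integral>\<^sup>+t. ennreal (norm (h (Suc k) t - h k t)) \<partial>M)"
    by (rule nn_integral_suminf[OF m])
  also have "\<dots> \<le> (\<Sum>k. ennreal (B k))"
    by (intro suminf_le B) auto
  also have "\<dots> = ennreal (\<Sum>k. B k)"
    by (rule suminf_ennreal2[OF B0 sB])
  finally have "(\<integral>\<^sup>+t. (\<Sum>k. ennreal (norm (h (Suc k) t - h k t))) \<partial>M) \<noteq> \<infinity>"
    by (auto simp: top_unique)
  then have "AE t in M. (\<Sum>k. ennreal (norm (h (Suc k) t - h k t))) \<noteq> \<infinity>"
    using meas by (intro nn_integral_PInf_AE) measurable
  then show ?thesis
  proof eventually_elim
    case (elim t)
    then have "summable (\<lambda>k. norm (h (Suc k) t - h k t))"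
      by (intro summable_suminf_not_top) auto
    then have "summable (\<lambda>k. h (Suc k) t - h k t)"
      by (rule summable_norm_cancel)
    then have "convergent (\<lambda>n. \<Sum>k<n. h (Suc k) t - h k t)"
      by (simp add: summable_iff_convergent)
    then have "convergent (\<lambda>n. h n t - h 0 t)"
      using sum_lessThan_telescope[of "\<lambda>k. h k t"] by simp
    then show ?case
      using convergent_add[OF _ convergent_const[of "h 0 t"]] by fastforce
  qed
qed

text \<open>
  Let \<open>c\<^sub>n\<close> be the infimum of the \<open>L\<^sup>2\<close> energies of
  combinations of members with index at least \<open>n\<close>. The numbers
  \<open>c\<^sub>n\<close> increase and are bounded, hence converge. For near-minimizers
  \<open>g\<^sub>n\<close> the parallelogram identity bounds the energy of \<open>g\<^sub>m -
  g\<^sub>n\<close>, as their midpoint has energy at least \<open>c\<^sub>n\<close>. So they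
  form an \<open>L\<^sup>2\<close> Cauchy sequence, and a fast subsequence converges almost
  everywhere.
\<close>
lemma midpoint_hull_AE_convergent:
  fixes f :: "nat \<Rightarrow> 'a \<Rightarrow> 'v::euclidean_space"
  assumes "finite_measure M"
    and meas: "\<And>n. f n \<in> borel_measurable M" and bd: "\<And>n t. norm (f n t) \<le> C"
  obtains h where "\<And>k. h k \<in> midpoint_hull (f ` {k..})" "AE t in M. convergent (\<lambda>k. h k t)"
proof -
  interpret finite_measure M by fact
  define H where "H n = midpoint_hull (f ` {n..})" for n
  have Hmono: "H n \<subseteq> H m" if "m \<le> n" for m n
    unfolding H_def using that by (intro midpoint_hull_mono image_mono) auto
  have Hm: "g \<in> borel_measurable M" if "g \<in> H n" for g n
    using that meas unfolding H_def by (intro midpoint_hull_measurable[of g "f ` {n..}"]) auto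
  have Hb: "norm (g t) \<le> C" if "g \<in> H n" for g n t
    using that bd unfolding H_def by (intro midpoint_hull_bounded[of g "f ` {n..}"]) auto
  have C0: "0 \<le> C" by (rule order_trans[OF norm_ge_zero bd[of 0 undefined]])
  define E where "E g = (\<integral>t. (norm (g t))\<^sup>2 \<partial>M)" for g :: "'a \<Rightarrow> 'v"
  have sq: "(norm (g t))\<^sup>2 \<le> D\<^sup>2" if "norm (g t) \<le> D" for g :: "'a \<Rightarrow> 'v" and t D
    using that by (intro power_mono) auto
  have intsq: "integrable M (\<lambda>t. (norm (g t))\<^sup>2)"
    if "g \<in> borel_measurable M" "\<And>t. norm (g t) \<le> D" for g :: "'a \<Rightarrow> 'v" and D
    using that sq by (intro integrable_const_bound[where B = "D\<^sup>2"]) auto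
  have E0: "0 \<le> E g" for g
    unfolding E_def by (rule integral_nonneg_AE) auto
  have EC: "E g \<le> C\<^sup>2 * measure M (space M)" if "g \<in> H n" for g n
  proof -
    have "E g \<le> (\<integral>t. C\<^sup>2 \<partial>M)"
      unfolding E_def by (intro integral_mono intsq[OF Hm Hb] sq Hb) (use that in auto)
    then show ?thesis by (simp add: mult.commute)
  qed
  define c where "c n = Inf (E ` H n)" for n
  have ne: "E ` H n \<noteq> {}" for n
    using midpoint_hull.base[of "f n" "f ` {n..}"] by (auto simp: H_def)
  have bb: "bdd_below (E ` H n)" for n
    using E0 by (intro bdd_belowI2[of _ 0]) auto
  have c_le: "c n \<le> E g" if "g \<in> H n" for g n
    unfolding c_def using that by (intro cInf_lower bb) auto
  have "incseq c"
    unfolding c_def by (intro monoI cInf_superset_mono ne bb image_mono Hmono)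
  moreover have "c n \<le> C\<^sup>2 * measure M (space M)" for n
    using ne[of n] c_le EC by (meson ex_in_conv imageE order_trans)
  ultimately obtain cl where cl: "c \<longlonglongrightarrow> cl" "\<And>n. c n \<le> cl"
    using incseq_convergent by blast
  have "\<exists>g\<in>H n. E g < c n + 1 / Suc n" for n
    using cInf_lessD[OF ne, of n "c n + 1 / Suc n"] by (auto simp: c_def)
  then obtain g where g: "\<And>n. g n \<in> H n" "\<And>n. E (g n) < c n + 1 / Suc n"
    by metis
  \<comment> \<open>the parallelogram identity, with the midpoint again in \<open>H n\<close>\<close>
  have par: "E (\<lambda>t. g m t - g n t) \<le> 2 * (cl - c n) + 4 / Suc n" if mn: "n \<le> m" for m n
  proof -
    have i: "integrable M (\<lambda>t. (norm (g k t))\<^sup>2)" for k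
      by (rule intsq[OF Hm[OF g(1)] Hb[OF g(1)]])
    have mid: "(\<lambda>t. (1/2) *\<^sub>R (g m t + g n t)) \<in> H n"
      using g(1) Hmono[OF mn] unfolding H_def by (intro midpoint_hull.midpoint) auto
    have im: "integrable M (\<lambda>t. (norm ((1/2) *\<^sub>R (g m t + g n t)))\<^sup>2)"
      by (rule intsq[OF Hm[OF mid] Hb[OF mid]])
    have pt: "(norm (x - y))\<^sup>2 = 2 * (norm x)\<^sup>2 + 2 * (norm y)\<^sup>2 - 4 * (norm ((1/2) *\<^sub>R (x + y)))\<^sup>2" for x y :: 'v
      by (simp add: power2_norm_eq_inner inner_simps algebra_simps)
    have "E (\<lambda>t. g m t - g n t) = 2 * E (g m) + 2 * E (g n) - 4 * E (\<lambda>t. (1/2) *\<^sub>R (g m t + g n t))"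
      unfolding E_def pt using i im by simp
    also have "\<dots> \<le> 2 * (c m + 1 / Suc m) + 2 * (c n + 1 / Suc n) - 4 * c n"
    proof -
      have "2 * x + 2 * y - 4 * z \<le> 2 * a + 2 * b - 4 * w" if "x < a" "y < b" "w \<le> z" for x y z a b w :: real
        using that by linarith
      from this[OF g(2) g(2) c_le[OF mid]] show ?thesis .
    qed
    also have "\<dots> \<le> 2 * (cl - c n) + 4 / Suc n"
    proof -
      have le: "1 / real (Suc m) \<le> 1 / real (Suc n)" using mn by (intro divide_left_mono) auto
      have "2 * (x + p) + 2 * (y + q) - 4 * y \<le> 2 * (z - y) + 4 * q"
        if "p \<le> q" "x \<le> z" for x y z p q :: real
        using that by argo
      from this[OF le cl(2)] show ?thesis by simp
    qed
    finally show ?thesis .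
  qed
  have "(\<lambda>n. 2 * (cl - c n) + 4 * (1 / real (Suc n))) \<longlonglongrightarrow> 2 * (cl - cl) + 4 * 0"
    using cl(1) LIMSEQ_inverse_real_of_nat by (intro tendsto_intros) (auto simp: inverse_eq_divide)
  then have lim0: "(\<lambda>n. 2 * (cl - c n) + 4 / real (Suc n)) \<longlonglongrightarrow> 0" by simp
  have "\<exists>N. \<forall>n\<ge>N. 2 * (cl - c n) + 4 / real (Suc n) < (1/4) ^ k" for k
    using order_tendstoD(2)[OF lim0, of "(1/4)^k"] by (simp add: eventually_sequentially)
  then obtain N where N: "\<And>k n. n \<ge> N k \<Longrightarrow> 2 * (cl - c n) + 4 / real (Suc n) < (1/4) ^ k"
    by metis
  \<comment> \<open>increasing, and at least as large as both \<open>N k\<close> and \<open>k\<close>\<close>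
  define s where "s k = k + (\<Sum>j\<le>k. N j)" for k
  have s: "s k \<ge> N k" "s k \<ge> k" "s k \<le> s (Suc k)" for k
    by (auto simp: s_def trans_le_add2 member_le_sum)
  define h where "h k = g (s k)" for k
  have hH: "h k \<in> H k" for k
    using g(1)[of "s k"] Hmono[OF s(2)] by (auto simp: h_def)
  have hm: "h k \<in> borel_measurable M" for k by (rule Hm[OF hH])
  have hb: "norm (h k t) \<le> C" for k t by (rule Hb[OF hH])
  have E4: "E (\<lambda>t. h (Suc k) t - h k t) \<le> (1/4) ^ k" for k
    using par[OF s(3), of k] N[OF s(1), of k] by (simp add: h_def)
  define \<mu> where "\<mu> = measure M (space M)"
  define B where "B k = (1/2) ^ k * (\<mu> + 1)" for k
  have "AE t in M. convergent (\<lambda>k. h k t)"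
  proof (rule AE_convergent_of_fast_L1_Cauchy[OF hm, where B = B])
    show "0 \<le> B k" for k by (simp add: B_def \<mu>_def)
    show "summable B" unfolding B_def by (intro summable_mult2 summable_geometric) simp
    show "(\<integral>\<^sup>+t. ennreal (norm (h (Suc k) t - h k t)) \<partial>M) \<le> ennreal (B k)" for k
    proof -
      define d where "d t = h (Suc k) t - h k t" for t
      have dm: "d \<in> borel_measurable M" unfolding d_def using hm by measurable
      have db: "norm (d t) \<le> 2 * C" for t
        unfolding d_def using norm_triangle_ineq4[of "h (Suc k) t" "h k t"] hb[of "Suc k" t] hb[of k t] by linarith
      have i2: "integrable M (\<lambda>t. (norm (d t))\<^sup>2)" by (rule intsq[OF dm db])
      have i1: "integrable M (\<lambda>t. norm (d t))"
        using dm db by (intro integrable_const_bound[where B = "2 * C"]) auto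
      \<comment> \<open>trades the first power for the square, at a price summable in \<open>k\<close>\<close>
      have am: "norm x \<le> (1/2)^k + 2^k * (norm x)\<^sup>2" for x :: 'v
      proof (cases "norm x \<le> (1/2)^k")
        case True
        have "0 \<le> 2^k * (norm x)\<^sup>2" by simp
        with True show ?thesis by linarith
      next
        case False
        then have "2^k * (1/2)^k * norm x \<le> 2^k * norm x * norm x"
          by (intro mult_right_mono) auto
        moreover have "(2::real)^k * (1/2)^k = 1" by (simp add: power_mult_distrib[symmetric])
        ultimately have "norm x \<le> 2^k * (norm x)\<^sup>2" by (simp add: power2_eq_square mult.assoc)
        then show ?thesis by (rule add_increasing[rotated]) simp
      qed
      have "(\<integral>t. norm (d t) \<partial>M) \<le> (\<integral>t. (1/2)^k + 2^k * (norm (d t))\<^sup>2 \<partial>M)"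
        using i1 i2 am by (intro integral_mono) auto
      also have "\<dots> = (1/2)^k * \<mu> + 2^k * E d"
        using i2 by (simp add: E_def \<mu>_def)
      also have "\<dots> \<le> (1/2)^k * \<mu> + 2^k * (1/4)^k"
        using E4[of k] by (intro add_left_mono mult_left_mono) (auto simp: d_def[abs_def])
      also have "\<dots> = B k"
      proof -
        have "(2::real)^k * (1/4)^k = (1/2)^k" by (simp add: power_mult_distrib[symmetric])
        then show ?thesis by (simp add: B_def algebra_simps)
      qed
      finally have "(\<integral>t. norm (d t) \<partial>M) \<le> B k" .
      then show ?thesis
        using nn_integral_eq_integral[OF i1] by (simp add: d_def[symmetric] ennreal_leI)
    qed
  qed
  then show thesis by (rule that[OF hH[unfolded H_def]])
qed

lemma midpoint_hull_integral_near:
  fixes f :: "'a::euclidean_space \<Rightarrow> 'v::euclidean_space"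
  assumes "f \<in> midpoint_hull S"
    and "\<And>g. g \<in> S \<Longrightarrow> g integrable_on I \<and> norm (integral I g - l) \<le> e"
  shows "f integrable_on I \<and> norm (integral I f - l) \<le> e"
  using assms(1)
proof induction
  case (midpoint f g)
  have "integral I (\<lambda>t. (1/2) *\<^sub>R (f t + g t)) - l = (1/2) *\<^sub>R ((integral I f - l) + (integral I g - l))"
    using midpoint by (simp add: Henstock_Kurzweil_Integration.integral_add algebra_simps flip: scaleR_add_left)
  then have "norm (integral I (\<lambda>t. (1/2) *\<^sub>R (f t + g t)) - l) \<le> e"
    using midpoint norm_triangle_ineq[of "integral I f - l" "integral I g - l"] by simp
  then show ?case
    using midpoint by (auto intro!: integrable_add integrable_cmul)
qed (use assms in auto)

section \<open>Weak sequential compactness and weak limits of controls\<close>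

text \<open>
  The lemma on midpoint combinations needs a finite measure, so Lebesgue measure is weighted
  with a positive integrable density; this does not change the null sets. The limit of the
  combinations takes values in the closed convex set \<open>U\<close>. Its integral is the limit
  of the integrals of the subsequence, because the \<open>k\<close>-th combination involves only
  members from index \<open>k\<close> on.
\<close>
lemma weak_sequential_compactness:
  fixes u :: "nat \<Rightarrow> real \<Rightarrow> 'v::euclidean_space"
  assumes U: "compact U" "convex U"
    and meas: "\<And>n. u n \<in> borel_measurable lebesgue" and uU: "\<And>n t. u n t \<in> U"
  obtains r v where "strict_mono (r :: nat \<Rightarrow> nat)" "v \<in> borel_measurable lebesgue" "\<And>t. v t \<in> U"
    "\<And>a b. (\<lambda>n. integral {a..b} (u (r n))) \<longlonglongrightarrow> integral {a..b} v"
proof -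
  obtain C where C: "\<And>x. x \<in> U \<Longrightarrow> norm x \<le> C"
    using U(1) by (meson bounded_iff compact_imp_bounded)
  obtain r where r: "strict_mono (r :: nat \<Rightarrow> nat)"
    "\<And>a b. convergent (\<lambda>n. integral {a..b} (u (r n)))"
    by (rule subsequence_convergent_integrals[of u C]) (use meas C uU in auto)
  obtain \<rho> :: "real \<Rightarrow> ennreal" where \<rho>': "\<rho> \<in> borel_measurable lborel"
      "integral\<^sup>N lborel \<rho> \<noteq> \<infinity>" "\<And>t. 0 < \<rho> t"
    using sigma_finite_measure.Ex_finite_integrable_function[OF lborel.sigma_finite_measure_axioms] by auto
  then have \<rho>: "\<rho> \<in> borel_measurable lebesgue" "integral\<^sup>N lebesgue \<rho> \<noteq> \<infinity>" "\<And>t. 0 < \<rho> t"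
    by (simp_all add: measurable_completion nn_integral_completion)
  define M where "M = density lebesgue \<rho>"
  have fM: "finite_measure M"
    using \<rho> by (intro finite_measureI) (simp add: M_def emeasure_density)
  have Mm: "borel_measurable M = (borel_measurable lebesgue :: (real \<Rightarrow> 'v) set)"
    by (intro measurable_cong_sets) (simp_all add: M_def)
  obtain h where h: "\<And>k. h k \<in> midpoint_hull ((\<lambda>n. u (r n)) ` {k..})" "AE t in M. convergent (\<lambda>k. h k t)"
    by (rule midpoint_hull_AE_convergent[OF fM, of "\<lambda>n. u (r n)" C]) (use meas C uU Mm in auto)
  have "AE t in lebesgue. convergent (\<lambda>k. h k t)"
    using h(2) \<rho>(3) unfolding M_def AE_density[OF \<rho>(1)] by simp
  then obtain N where N: "N \<in> null_sets lebesgue" "{t. \<not> convergent (\<lambda>k. h k t)} \<subseteq> N"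
    by (auto simp: eventually_ae_filter)
  have neg: "negligible N" using N by (simp add: negligible_iff_null_sets)
  have hm: "h k \<in> borel_measurable lebesgue" for k
    by (rule midpoint_hull_measurable[OF h(1)]) (use meas in auto)
  have hU: "h k t \<in> U" for k t
    by (rule midpoint_hull_convex[OF h(1) U(2)]) (use uU in auto)
  define v where "v t = (if lim (\<lambda>k. h k t) \<in> U then lim (\<lambda>k. h k t) else u 0 t)" for t
  have vm: "v \<in> borel_measurable lebesgue"
  proof -
    have [measurable]: "(\<lambda>t. lim (\<lambda>k. h k t)) \<in> borel_measurable lebesgue"
      by (rule borel_measurable_lim_metric[OF hm])
    have [measurable]: "U \<in> sets borel" using U(1) by (simp add: borel_compact)
    show ?thesis unfolding v_def[abs_def] using meas by measurable
  qed
  have vU: "v t \<in> U" for t using uU by (simp add: v_def)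
  have hv: "(\<lambda>k. h k t) \<longlonglongrightarrow> v t" if "t \<notin> N" for t
  proof -
    have "(\<lambda>k. h k t) \<longlonglongrightarrow> lim (\<lambda>k. h k t)"
      using that N(2) convergent_LIMSEQ_iff by blast
    moreover from this have "lim (\<lambda>k. h k t) \<in> U"
      using closed_sequentially[OF compact_imp_closed[OF U(1)], of "\<lambda>k. h k t"] hU by blast
    ultimately show ?thesis by (simp add: v_def)
  qed
  have "(\<lambda>n. integral {a..b} (u (r n))) \<longlonglongrightarrow> integral {a..b} v" for a b
  proof -
    obtain l where l: "(\<lambda>n. integral {a..b} (u (r n))) \<longlonglongrightarrow> l"
      using r(2) by (auto simp: convergent_def)
    have "(\<lambda>k. integral {a..b} (h k)) \<longlonglongrightarrow> l"
    proof (rule LIMSEQ_I)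
      fix e :: real assume e: "0 < e"
      then obtain K where K: "\<And>n. n \<ge> K \<Longrightarrow> norm (integral {a..b} (u (r n)) - l) < e / 2"
        using LIMSEQ_D[OF l, of "e / 2"] by auto
      have "norm (integral {a..b} (h k) - l) \<le> e / 2" if "k \<ge> K" for k
      proof (rule conjunct2[OF midpoint_hull_integral_near[OF h(1)]])
        fix g assume "g \<in> (\<lambda>n. u (r n)) ` {k..}"
        then obtain n where "n \<ge> k" "g = u (r n)" by auto
        then show "g integrable_on {a..b} \<and> norm (integral {a..b} g - l) \<le> e / 2"
          using K[of n] that bounded_measurable_integrable[OF meas C[OF uU]] by auto
      qed
      then show "\<exists>K. \<forall>k\<ge>K. norm (integral {a..b} (h k) - l) < e"
        using e by (intro exI[of _ K]) fastforce
    qed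
    moreover have "(\<lambda>k. integral {a..b} (h k)) \<longlonglongrightarrow> integral {a..b} v"
    proof -
      define h' where "h' k t = (if t \<in> N then v t else h k t)" for k t
      have int: "h' k integrable_on {a..b}" for k
        by (rule integrable_spike[OF bounded_measurable_integrable[OF hm C[OF hU]] neg]) (auto simp: h'_def)
      have "(\<lambda>k. integral {a..b} (h' k)) \<longlonglongrightarrow> integral {a..b} v"
      proof (rule dominated_convergence(2)[OF int, where h = "\<lambda>_. C"])
        show "norm (h' k t) \<le> C" for k t
          using C hU vU by (simp add: h'_def)
        show "(\<lambda>k. h' k t) \<longlonglongrightarrow> v t" for t
          using hv[of t] by (cases "t \<in> N") (simp_all add: h'_def)
      qed auto
      moreover have "integral {a..b} (h' k) = integral {a..b} (h k)" for k
        by (rule integral_spike[OF neg]) (auto simp: h'_def)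
      ultimately show ?thesis by simp
    qed
    ultimately have "l = integral {a..b} v" using LIMSEQ_unique by blast
    with l show ?thesis by simp
  qed
  then show thesis using that r(1) vm vU by blast
qed

text \<open>
  On an interval so short that \<open>g\<close> is almost constant, \<open>\<integral> w\<^sub>n
  g\<close> is small relative to its length up to a term that tends to 0, and this estimate is
  additive over adjacent intervals. Since the primitives of \<open>w\<^sub>n g\<close> are
  uniformly Lipschitz, convergence on a finite net is uniform over all subintervals.
\<close>
lemma weak_limit_times_continuous:
  fixes w :: "nat \<Rightarrow> real \<Rightarrow> real" and g :: "real \<Rightarrow> 'e::euclidean_space"
  assumes meas: "\<And>n. w n \<in> borel_measurable lebesgue" and bd: "\<And>n t. \<bar>w n t\<bar> \<le> C"
    and lim: "\<And>c d. (\<lambda>n. integral {c..d} (w n)) \<longlonglongrightarrow> 0"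
    and g: "continuous_on {a..b} g" and e: "0 < e"
  shows "\<forall>\<^sub>F n in sequentially. \<forall>s t. a \<le> s \<and> s \<le> t \<and> t \<le> b \<longrightarrow>
    norm (integral {s..t} (\<lambda>\<tau>. w n \<tau> *\<^sub>R g \<tau>)) \<le> e"
proof (cases "a \<le> b")
  case ab: True
  have C0: "0 \<le> C" using bd[of 0 0] by linarith
  obtain G where G: "\<And>t. t \<in> {a..b} \<Longrightarrow> norm (g t) \<le> G" and G0: "0 \<le> G"
  proof -
    have "bounded (g ` {a..b})" using g by (intro compact_imp_bounded compact_continuous_image) auto
    then show thesis using that by (force simp: bounded_pos)
  qed
  have wint: "w n integrable_on {s..t}" for n s t
    using bounded_measurable_integrable[OF meas, of n C] bd by simp
  have absint: "(\<lambda>\<tau>. w n \<tau> *\<^sub>R f \<tau>) integrable_on {s..t}"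
    if f: "continuous_on {s..t} f" "\<And>\<tau>. \<tau> \<in> {s..t} \<Longrightarrow> norm (f \<tau>) \<le> D" for n s t D and f :: "real \<Rightarrow> 'e"
  proof -
    have "(\<lambda>\<tau>. w n \<tau> *\<^sub>R f \<tau>) absolutely_integrable_on {s..t}"
    proof (rule measurable_bounded_by_integrable_imp_absolutely_integrable[where g = "\<lambda>_. C * D"])
      show "(\<lambda>\<tau>. w n \<tau> *\<^sub>R f \<tau>) \<in> borel_measurable (lebesgue_on {s..t})"
        by (intro borel_measurable_scaleR measurable_restrict_space1[OF meas]
            continuous_imp_measurable_on_sets_lebesgue[OF f(1)]) auto
      show "norm (w n \<tau> *\<^sub>R f \<tau>) \<le> C * D" if "\<tau> \<in> {s..t}" for \<tau>
        using that f(2) bd[of n \<tau>] C0 by (auto intro!: mult_mono)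
    qed auto
    then show ?thesis using set_lebesgue_integral_eq_integral(1) by blast
  qed
  have gint: "(\<lambda>\<tau>. w n \<tau> *\<^sub>R g \<tau>) integrable_on {s..t}" if "a \<le> s" "t \<le> b" for n s t
    using that G by (intro absint[where D = G] continuous_on_subset[OF g]) auto
  \<comment> \<open>a bound proportional to the length survives subdivision, hence Bolzano bisection applies\<close>
  have small: "\<forall>\<^sub>F n in sequentially. norm (integral {s..t} (\<lambda>\<tau>. w n \<tau> *\<^sub>R g \<tau>)) \<le> k * (t - s)"
    if st: "a \<le> s" "s \<le> t" "t \<le> b" and k: "0 < k" for s t k
  proof -
    let ?P = "\<lambda>p q. a \<le> p \<longrightarrow> q \<le> b \<longrightarrow>
      (\<forall>\<^sub>F n in sequentially. norm (integral {p..q} (\<lambda>\<tau>. w n \<tau> *\<^sub>R g \<tau>)) \<le> k * (q - p))"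
    have "?P s t"
      using st(2)
    proof (induction s t rule: Bolzano)
      case (trans x y z)
      show ?case
      proof (intro impI)
        assume xz: "a \<le> x" "z \<le> b"
        have "\<forall>\<^sub>F n in sequentially. norm (integral {x..y} (\<lambda>\<tau>. w n \<tau> *\<^sub>R g \<tau>)) \<le> k * (y - x)"
          "\<forall>\<^sub>F n in sequentially. norm (integral {y..z} (\<lambda>\<tau>. w n \<tau> *\<^sub>R g \<tau>)) \<le> k * (z - y)"
          using trans xz by auto
        then show "\<forall>\<^sub>F n in sequentially. norm (integral {x..z} (\<lambda>\<tau>. w n \<tau> *\<^sub>R g \<tau>)) \<le> k * (z - x)"
        proof eventually_elim
          case (elim n)
          have "integral {x..z} (\<lambda>\<tau>. w n \<tau> *\<^sub>R g \<tau>)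
              = integral {x..y} (\<lambda>\<tau>. w n \<tau> *\<^sub>R g \<tau>) + integral {y..z} (\<lambda>\<tau>. w n \<tau> *\<^sub>R g \<tau>)"
            using trans(3,4) gint[OF xz]
            by (intro Henstock_Kurzweil_Integration.integral_combine[symmetric])
          also have "norm \<dots> \<le> k * (y - x) + k * (z - y)"
            using elim by (rule norm_triangle_mono)
          finally show ?case by (simp add: algebra_simps)
        qed
      qed
    next
      case (local x)
      have "0 < k / (2 * (C + 1))" using k C0 by simp
      moreover have x: "x \<in> {a..b}" using local st by auto
      ultimately obtain d where d: "0 < d"
        "\<And>\<tau>. \<lbrakk>\<tau> \<in> {a..b}; \<bar>\<tau> - x\<bar> < d\<rbrakk> \<Longrightarrow> norm (g \<tau> - g x) < k / (2 * (C + 1))"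
        using g unfolding continuous_on_iff dist_norm real_norm_def by metis
      have "\<forall>\<^sub>F n in sequentially. norm (integral {p..q} (\<lambda>\<tau>. w n \<tau> *\<^sub>R g \<tau>)) \<le> k * (q - p)"
        if pq: "p \<le> x" "x \<le> q" "q - p < d" "a \<le> p" "q \<le> b" for p q
      proof (cases "p = q")
        case False
        then have "0 < k / 2 * (q - p)" using pq k by simp
        moreover have "(\<lambda>n. integral {p..q} (w n) *\<^sub>R g x) \<longlonglongrightarrow> 0"
          using tendsto_scaleR[OF lim[of p q] tendsto_const[of "g x"]] by simp
        ultimately have "\<forall>\<^sub>F n in sequentially. norm (integral {p..q} (w n) *\<^sub>R g x) < k / 2 * (q - p)"
          using tendstoD by fastforce
        then show ?thesis
        proof eventually_elim
          case (elim n)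
          have near: "norm (g \<tau> - g x) \<le> k / (2 * (C + 1))" if "\<tau> \<in> {p..q}" for \<tau>
            using that d(2)[of \<tau>] pq by (intro less_imp_le) auto
          have cont: "continuous_on {p..q} (\<lambda>\<tau>. g \<tau> - g x)"
            using pq by (intro continuous_intros continuous_on_subset[OF g]) auto
          have i1: "(\<lambda>\<tau>. w n \<tau> *\<^sub>R (g \<tau> - g x)) integrable_on {p..q}"
            using cont near by (rule absint)
          have i2: "(\<lambda>\<tau>. w n \<tau> *\<^sub>R g x) integrable_on {p..q}"
            using wint by (intro integrable_on_scaleR_left)
          have "integral {p..q} (\<lambda>\<tau>. w n \<tau> *\<^sub>R g \<tau>)
              = integral {p..q} (\<lambda>\<tau>. w n \<tau> *\<^sub>R (g \<tau> - g x) + w n \<tau> *\<^sub>R g x)"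
            by (simp add: algebra_simps)
          also have "\<dots> = integral {p..q} (\<lambda>\<tau>. w n \<tau> *\<^sub>R (g \<tau> - g x)) + integral {p..q} (w n) *\<^sub>R g x"
            using integral_unique[OF has_integral_scaleR_left[OF integrable_integral[OF wint[of n p q]], of "g x"]]
            by (simp add: Henstock_Kurzweil_Integration.integral_add[OF i1 i2])
          also have "norm \<dots> \<le> k / 2 * (q - p) + k / 2 * (q - p)"
          proof (rule norm_triangle_mono)
            show "norm (integral {p..q} (\<lambda>\<tau>. w n \<tau> *\<^sub>R (g \<tau> - g x))) \<le> k / 2 * (q - p)"
            proof (rule norm_integral_le_length[OF i1])
              fix \<tau> assume \<tau>: "\<tau> \<in> {p..q}"
              have "norm (w n \<tau> *\<^sub>R (g \<tau> - g x)) \<le> (C + 1) * (k / (2 * (C + 1)))"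
                using near[OF \<tau>] bd[of n \<tau>] C0 by (simp del: times_divide_eq_right) (intro mult_mono; simp)
              also have "\<dots> = k / 2" using C0 by (simp add: divide_simps)
              finally show "norm (w n \<tau> *\<^sub>R (g \<tau> - g x)) \<le> k / 2" .
            qed (use pq in auto)
          qed (use elim in simp)
          finally show ?case by simp
        qed
      qed simp
      then show ?case using d(1) by blast
    qed
    then show ?thesis using st by simp
  qed
  have lim0: "(\<lambda>n. integral {a..t} (\<lambda>\<tau>. w n \<tau> *\<^sub>R g \<tau>)) \<longlonglongrightarrow> 0" if t: "a \<le> t" "t \<le> b" for t
  proof (rule tendstoI)
    fix \<epsilon> :: real assume "0 < \<epsilon>"
    then have "0 < \<epsilon> / (2 * (t - a + 1))" using t by simp
    from small[OF order_refl t this]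
    show "\<forall>\<^sub>F n in sequentially. dist (integral {a..t} (\<lambda>\<tau>. w n \<tau> *\<^sub>R g \<tau>)) 0 < \<epsilon>"
    proof eventually_elim
      case (elim n)
      also have "\<epsilon> / (2 * (t - a + 1)) * (t - a) < \<epsilon>"
        using t \<open>0 < \<epsilon>\<close> by (simp add: divide_simps)
      finally show ?case by simp
    qed
  qed
  define h where "h = e / (4 * (C * G + 1))"
  have h: "0 < h" "C * G * h \<le> e / 4"
  proof -
    have K: "0 \<le> C * G" using C0 G0 by simp
    then show "0 < h" using e by (simp add: h_def)
    then have "C * G * h \<le> (C * G + 1) * h" by (simp add: algebra_simps)
    also have "\<dots> = e / 4"
    proof -
      have "x * (e / (4 * x)) = e / 4" if "x \<noteq> 0" for x :: real using that by simp
      from this[of "C * G + 1"] show ?thesis using K by (simp add: h_def del: times_divide_eq_right)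
    qed
    finally show "C * G * h \<le> e / 4" .
  qed
  obtain T where T: "T \<subseteq> {a..b}" "finite T" "{a..b} \<subseteq> (\<Union>c\<in>T. ball c h)"
    by (rule compactE_image[of "{a..b}" "{a..b}" "\<lambda>c. ball c h"]) (use h in auto)
  have "\<forall>\<^sub>F n in sequentially. \<forall>c\<in>T. norm (integral {a..c} (\<lambda>\<tau>. w n \<tau> *\<^sub>R g \<tau>)) < e / 4"
    using T(1) e tendstoD[OF lim0, of _ "e / 4"] by (intro eventually_ball_finite T(2)) auto
  then show ?thesis
  proof eventually_elim
    case (elim n)
    let ?I = "\<lambda>s t. integral {s..t} (\<lambda>\<tau>. w n \<tau> *\<^sub>R g \<tau>)"
    have comb: "?I s t = ?I a t - ?I a s" if "a \<le> s" "s \<le> t" "t \<le> b" for s t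
      using Henstock_Kurzweil_Integration.integral_combine[of a s t "\<lambda>\<tau>. w n \<tau> *\<^sub>R g \<tau>"] that gint by (simp add: algebra_simps)
    have lip: "norm (?I s t) \<le> C * G * (t - s)" if "a \<le> s" "s \<le> t" "t \<le> b" for s t
      using that G bd[of n] C0 by (intro norm_integral_le_length gint) (auto intro!: mult_mono)
    have E: "norm (?I a t) \<le> e / 2" if t: "a \<le> t" "t \<le> b" for t
    proof -
      obtain c where c: "c \<in> T" "\<bar>c - t\<bar> < h" using T(3) t by (force simp: dist_real_def)
      have cab: "a \<le> c" "c \<le> b" using c T(1) by auto
      have "norm (?I a t - ?I a c) \<le> C * G * \<bar>c - t\<bar>"
      proof (cases "c \<le> t")
        case True
        then show ?thesis using lip[of c t] comb[of c t] cab t by simp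
      next
        case False
        then show ?thesis using lip[of t c] comb[of t c] cab t by (simp add: norm_minus_commute)
      qed
      also have "\<dots> \<le> C * G * h" using c C0 G0 by (intro mult_left_mono) auto
      also have "\<dots> \<le> e / 4" by (rule h)
      finally show ?thesis
        using elim c(1) norm_triangle_sub[of "?I a t" "?I a c"] by fastforce
    qed
    show ?case
    proof (intro allI impI)
      fix s t assume st: "a \<le> s \<and> s \<le> t \<and> t \<le> b"
      have "norm (?I a t - ?I a s) \<le> norm (?I a t) + norm (?I a s)" by (rule norm_triangle_ineq4)
      then show "norm (?I s t) \<le> e" using comb[of s t] E[of s] E[of t] st by simp
    qed
  qed
next
  case False
  then show ?thesis by (intro always_eventually) auto
qed

lemma weak_limit_linear_combination:
  fixes us :: "nat \<Rightarrow> real \<Rightarrow> real ^ 'm::finite" and g :: "'m \<Rightarrow> real \<Rightarrow> 'e::euclidean_space"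
  assumes um: "u \<in> borel_measurable lebesgue" and usm: "\<And>n. us n \<in> borel_measurable lebesgue"
    and ub: "\<And>t. norm (u t) \<le> C" and usb: "\<And>n t. norm (us n t) \<le> C"
    and weak: "\<And>p q. (\<lambda>n. integral {p..q} (us n)) \<longlonglongrightarrow> integral {p..q} u"
    and g: "\<And>i. continuous_on {a..b} (g i)" and e: "0 < e"
  shows "\<forall>\<^sub>F n in sequentially. \<forall>s t. a \<le> s \<and> s \<le> t \<and> t \<le> b \<longrightarrow>
    (\<lambda>\<tau>. \<Sum>i\<in>UNIV. (us n \<tau> $ i - u \<tau> $ i) *\<^sub>R g i \<tau>) integrable_on {s..t} \<and>
    norm (integral {s..t} (\<lambda>\<tau>. \<Sum>i\<in>UNIV. (us n \<tau> $ i - u \<tau> $ i) *\<^sub>R g i \<tau>)) \<le> e"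
proof -
  define w where "w i n t = us n t $ i - u t $ i" for i n t
  have usint: "us n integrable_on {p..q}" for n p q
    by (rule bounded_measurable_integrable[OF usm usb])
  have uint: "u integrable_on {p..q}" for p q
    by (rule bounded_measurable_integrable[OF um ub])
  have comp: "(\<lambda>t. f t $ i) \<in> borel_measurable lebesgue" if "f \<in> borel_measurable lebesgue"
    for f :: "real \<Rightarrow> real ^ 'm" and i
    using borel_measurable_inner[OF that borel_measurable_const[of "axis i 1"]] by (simp add: inner_axis)
  have wm: "w i n \<in> borel_measurable lebesgue" for i n
    unfolding w_def using comp um usm by (intro borel_measurable_diff) auto
  have wb: "\<bar>w i n t\<bar> \<le> 2 * C" for i n t
    unfolding w_def using component_le_norm_cart[of "us n t" i] component_le_norm_cart[of "u t" i] ub[of t] usb[of n t]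
    by linarith
  have wlim: "(\<lambda>n. integral {p..q} (w i n)) \<longlonglongrightarrow> 0" for i p q
  proof -
    have ci: "(\<lambda>t. f t $ i) integrable_on {p..q}" if "f integrable_on {p..q}" for f :: "real \<Rightarrow> real ^ 'm"
      using integrable_component[OF that, of "axis i 1"] by (simp add: inner_axis)
    have "integral {p..q} (w i n) = integral {p..q} (us n) $ i - integral {p..q} u $ i" for n
      unfolding w_def using ci usint uint by (simp add: Henstock_Kurzweil_Integration.integral_diff)
    moreover have "(\<lambda>n. integral {p..q} (us n) $ i - integral {p..q} u $ i) \<longlonglongrightarrow> integral {p..q} u $ i - integral {p..q} u $ i"
      by (intro tendsto_intros weak)
    ultimately show ?thesis by simp
  qed
  have int: "(\<lambda>\<tau>. w i n \<tau> *\<^sub>R g i \<tau>) integrable_on {s..t}" if st: "a \<le> s" "t \<le> b" for i n s t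
  proof -
    have cont: "continuous_on {s..t} (g i)" using st by (intro continuous_on_subset[OF g]) auto
    then have "bounded (g i ` {s..t})" by (intro compact_imp_bounded compact_continuous_image) auto
    then obtain D where D: "\<And>\<tau>. \<tau> \<in> {s..t} \<Longrightarrow> norm (g i \<tau>) \<le> D" by (force simp: bounded_iff)
    have "(\<lambda>\<tau>. w i n \<tau> *\<^sub>R g i \<tau>) absolutely_integrable_on {s..t}"
    proof (rule measurable_bounded_by_integrable_imp_absolutely_integrable[where g = "\<lambda>_. 2 * C * D"])
      show "(\<lambda>\<tau>. w i n \<tau> *\<^sub>R g i \<tau>) \<in> borel_measurable (lebesgue_on {s..t})"
        by (intro borel_measurable_scaleR measurable_restrict_space1[OF wm]
            continuous_imp_measurable_on_sets_lebesgue[OF cont]) auto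
      show "norm (w i n \<tau> *\<^sub>R g i \<tau>) \<le> 2 * C * D" if "\<tau> \<in> {s..t}" for \<tau>
      proof -
        have "0 \<le> 2 * C" using wb[of i n \<tau>] by linarith
        then show ?thesis using D[OF that] wb[of i n \<tau>] by (auto intro!: mult_mono)
      qed
    qed auto
    then show ?thesis using set_lebesgue_integral_eq_integral(1) by blast
  qed
  define k where "k = e / real CARD('m)"
  have k: "0 < k" using e by (simp add: k_def)
  have "\<forall>\<^sub>F n in sequentially. \<forall>i\<in>UNIV. \<forall>s t. a \<le> s \<and> s \<le> t \<and> t \<le> b \<longrightarrow>
      norm (integral {s..t} (\<lambda>\<tau>. w i n \<tau> *\<^sub>R g i \<tau>)) \<le> k"
    by (intro eventually_ball_finite finite ballI weak_limit_times_continuous[OF wm wb wlim g k])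
  then show ?thesis
  proof eventually_elim
    case (elim n)
    show ?case
    proof (intro allI impI conjI)
      fix s t assume st: "a \<le> s \<and> s \<le> t \<and> t \<le> b"
      show "(\<lambda>\<tau>. \<Sum>i\<in>UNIV. (us n \<tau> $ i - u \<tau> $ i) *\<^sub>R g i \<tau>) integrable_on {s..t}"
        using int st by (intro integrable_sum) (auto simp: w_def)
      have "integral {s..t} (\<lambda>\<tau>. \<Sum>i\<in>UNIV. w i n \<tau> *\<^sub>R g i \<tau>)
          = (\<Sum>i\<in>UNIV. integral {s..t} (\<lambda>\<tau>. w i n \<tau> *\<^sub>R g i \<tau>))"
        using int st by (intro Henstock_Kurzweil_Integration.integral_sum) auto
      also have "norm \<dots> \<le> (\<Sum>i\<in>(UNIV :: 'm set). k)"
        using elim st by (intro sum_norm_le) auto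
      also have "\<dots> = e" by (simp add: k_def)
      finally show "norm (integral {s..t} (\<lambda>\<tau>. \<Sum>i\<in>UNIV. (us n \<tau> $ i - u \<tau> $ i) *\<^sub>R g i \<tau>)) \<le> e"
        by (simp add: w_def)
    qed
  qed
qed

section \<open>Charts and vector fields in a chart\<close>

lemma is_chart_inverse:
  assumes "is_chart c" "p \<in> chart_dom c"
  shows "chart_inv c (chart_map c p) = p"
  using assms by (auto simp: is_chart_def homeomorphism_def)

lemma open_chart_preimage:
  assumes "is_chart c" "open S"
  shows "open {p \<in> chart_dom c. chart_map c p \<in> S}"
proof -
  have "continuous_on (chart_dom c) (chart_map c)" "open (chart_dom c)"
    using assms by (auto simp: is_chart_def homeomorphism_def)
  then have "open (chart_dom c \<inter> chart_map c -` S)"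
    using assms(2) by (rule continuous_open_preimage)
  then show ?thesis by (simp add: vimage_def Int_def)
qed

text \<open>
  Closed in the whole space, not only in the chart domain: a curve can leave the preimage of a
  ball only by crossing its boundary inside the chart.
\<close>
lemma closed_chart_preimage_compact:
  fixes c :: "('a::t2_space, 'e::euclidean_space) chart"
  assumes c: "is_chart c" and K: "compact K" "K \<subseteq> chart_map c ` chart_dom c"
  shows "closed {p \<in> chart_dom c. chart_map c p \<in> K}"
proof -
  have "{p \<in> chart_dom c. chart_map c p \<in> K} = chart_inv c ` K"
    using K(2) is_chart_inverse[OF c] by (force simp: image_iff)
  moreover have "continuous_on K (chart_inv c)"
    using c K(2) by (auto simp: is_chart_def homeomorphism_def intro: continuous_on_subset)
  ultimately show ?thesis
    using K(1) by (simp add: compact_continuous_image compact_imp_closed)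
qed

text \<open>
  Outside its domain the coordinate map is arbitrary, so the sequence has to lie in the domain
  eventually.
\<close>
lemma tendsto_iff_chart:
  fixes c :: "('a::t2_space, 'e::euclidean_space) chart"
  assumes c: "is_chart c" and l: "l \<in> chart_dom c" and f: "\<forall>\<^sub>F n in F. f n \<in> chart_dom c"
  shows "(f \<longlongrightarrow> l) F \<longleftrightarrow> ((\<lambda>n. chart_map c (f n)) \<longlongrightarrow> chart_map c l) F"
proof
  assume "(f \<longlongrightarrow> l) F"
  moreover have "continuous_on (chart_dom c) (chart_map c)"
    using c by (auto simp: is_chart_def homeomorphism_def)
  ultimately show "((\<lambda>n. chart_map c (f n)) \<longlongrightarrow> chart_map c l) F"
    using continuous_on_tendsto_compose l f by blast
next
  assume "((\<lambda>n. chart_map c (f n)) \<longlongrightarrow> chart_map c l) F"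
  moreover have "continuous_on (chart_map c ` chart_dom c) (chart_inv c)"
    using c by (auto simp: is_chart_def homeomorphism_def)
  moreover have "\<forall>\<^sub>F n in F. chart_map c (f n) \<in> chart_map c ` chart_dom c"
    using f by eventually_elim auto
  ultimately have "((\<lambda>n. chart_inv c (chart_map c (f n))) \<longlongrightarrow> chart_inv c (chart_map c l)) F"
    using continuous_on_tendsto_compose l by blast
  moreover have "\<forall>\<^sub>F n in F. chart_inv c (chart_map c (f n)) = f n"
    using f by eventually_elim (rule is_chart_inverse[OF c])
  ultimately show "(f \<longlongrightarrow> l) F"
    using tendsto_cong is_chart_inverse[OF c l] by force
qed

text \<open>
  The operator norm of the derivative is at most the sum of the norms of its values on the
  basis, which is continuous and hence bounded on the compact ball; convexity of the ball gives
  the mean value inequality.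
\<close>
lemma Ck1_lipschitz_on_cball:
  fixes f :: "'e::euclidean_space \<Rightarrow> 'f::euclidean_space"
  assumes f: "Ck_on (Suc 0) V f" and sub: "cball z R \<subseteq> V"
  obtains L where "L-lipschitz_on (cball z R) f"
proof -
  let ?D = "\<lambda>x. frechet_derivative f (at x)"
  have diff: "(f has_derivative ?D x) (at x)" if "x \<in> cball z R" for x
  proof -
    have "x \<in> V" using that sub by blast
    then show ?thesis using f frechet_derivative_works[of f "at x"] by simp
  qed
  define s where "s x = (\<Sum>i\<in>Basis. norm (?D x i))" for x
  have "continuous_on (cball z R) s"
    unfolding s_def using f sub by (intro continuous_intros) (auto intro: continuous_on_subset)
  then have "bounded (s ` cball z R)"
    by (intro compact_imp_bounded compact_continuous_image) auto
  then obtain L where L: "0 < L" "\<And>x. x \<in> cball z R \<Longrightarrow> s x \<le> L"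
    by (force simp: bounded_pos)
  have "L-lipschitz_on (cball z R) f"
  proof (rule lipschitz_onI)
    fix x y assume xy: "x \<in> cball z R" "y \<in> cball z R"
    have "norm (f x - f y) \<le> L * norm (x - y)"
    proof (rule differentiable_bound[OF convex_cball _ _ xy])
      show "(f has_derivative ?D x) (at x within cball z R)" if "x \<in> cball z R" for x
        using diff[OF that] has_derivative_at_withinI by blast
      show "onorm (?D x) \<le> L" if "x \<in> cball z R" for x
        using onorm_componentwise[OF has_derivative_bounded_linear[OF diff[OF that]]] L(2)[OF that]
        by (simp add: s_def)
    qed
    then show "dist (f x) (f y) \<le> L * dist x y" by (simp add: dist_norm)
  qed (use L in simp)
  then show thesis by (rule that)
qed

text \<open>
  The controlled vector field written as an ordinary map between coordinate spaces.
\<close>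
definition chart_field ::
  "('a, 'e::euclidean_space) vector_field \<Rightarrow> ('m::finite \<Rightarrow> ('a, 'e) vector_field) \<Rightarrow>
   ('a, 'e) chart \<Rightarrow> real ^ 'm \<Rightarrow> 'e \<Rightarrow> 'e" where
  "chart_field X\<^sub>0 X c w z = control_affine_field X\<^sub>0 X w (chart_inv c z) c"

lemma chart_field_eq:
  "chart_field X\<^sub>0 X c w z = X\<^sub>0 (chart_inv c z) c + (\<Sum>i\<in>UNIV. (w $ i) *\<^sub>R X i (chart_inv c z) c)"
  by (simp add: chart_field_def control_affine_field_def)

text \<open>
  One bound and one Lipschitz constant serve all control values at once because \<open>U\<close>
  is bounded and the control enters affinely.
\<close>
lemma chart_field_bounded_lipschitz_on_cball:
  fixes X :: "'m::finite \<Rightarrow> ('a::topological_space, 'e::euclidean_space) vector_field"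
  assumes X0: "smooth_vector_field A X\<^sub>0" and X: "\<And>i. smooth_vector_field A (X i)" and c: "c \<in> A"
    and U: "bounded U" and sub: "cball z R \<subseteq> chart_map c ` chart_dom c"
  obtains B L where "0 \<le> B" "0 \<le> L"
    "\<And>w y. \<lbrakk>w \<in> U; y \<in> cball z R\<rbrakk> \<Longrightarrow> norm (chart_field X\<^sub>0 X c w y) \<le> B"
    "\<And>w. w \<in> U \<Longrightarrow> L-lipschitz_on (cball z R) (chart_field X\<^sub>0 X c w)"
proof -
  obtain C where C: "0 < C" "\<And>w. w \<in> U \<Longrightarrow> norm w \<le> C" using U by (force simp: bounded_pos)
  have lip: "\<exists>L. L-lipschitz_on (cball z R) (\<lambda>y. Y (chart_inv c y) c)" if "smooth_vector_field A Y" for Y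
    using that c Ck1_lipschitz_on_cball[OF _ sub] unfolding smooth_vector_field_def smooth_on_def by metis
  obtain L0 where L0: "L0-lipschitz_on (cball z R) (\<lambda>y. X\<^sub>0 (chart_inv c y) c)" using lip[OF X0] by blast
  obtain Li where Li: "\<And>i. (Li i)-lipschitz_on (cball z R) (\<lambda>y. X i (chart_inv c y) c)" using lip[OF X] by metis
  define L where "L = L0 + (\<Sum>i\<in>UNIV. C * Li i)"
  have wi: "\<bar>w $ i\<bar> \<le> C" if "w \<in> U" for w i
    using C(2)[OF that] component_le_norm_cart[of w i] by linarith
  have Linn: "0 \<le> Li i" for i using Li lipschitz_on_nonneg by blast
  have L0nn: "0 \<le> L0" using L0 lipschitz_on_nonneg by blast
  have Lnn: "0 \<le> L" unfolding L_def using C Linn L0nn by (intro add_nonneg_nonneg sum_nonneg) auto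
  have Llip: "L-lipschitz_on (cball z R) (chart_field X\<^sub>0 X c w)" if w: "w \<in> U" for w
  proof (rule lipschitz_onI[OF _ Lnn])
    fix x y assume xy: "x \<in> cball z R" "y \<in> cball z R"
    have "norm (chart_field X\<^sub>0 X c w x - chart_field X\<^sub>0 X c w y)
        = norm ((X\<^sub>0 (chart_inv c x) c - X\<^sub>0 (chart_inv c y) c)
          + (\<Sum>i\<in>UNIV. (w $ i) *\<^sub>R (X i (chart_inv c x) c - X i (chart_inv c y) c)))"
      by (simp add: chart_field_eq scaleR_diff_right sum_subtractf add_diff_add)
    also have "\<dots> \<le> L0 * dist x y + (\<Sum>i\<in>UNIV. C * (Li i * dist x y))"
    proof (intro norm_triangle_mono sum_norm_le)
      show "norm (X\<^sub>0 (chart_inv c x) c - X\<^sub>0 (chart_inv c y) c) \<le> L0 * dist x y"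
        using lipschitz_onD[OF L0 xy] by (simp add: dist_norm)
      show "norm ((w $ i) *\<^sub>R (X i (chart_inv c x) c - X i (chart_inv c y) c)) \<le> C * (Li i * dist x y)" for i
        using lipschitz_onD[OF Li xy, of i] wi[OF w, of i] C by (simp add: dist_norm mult_mono)
    qed
    also have "\<dots> = L * dist x y"
      by (simp add: L_def sum_distrib_left sum_distrib_right algebra_simps)
    finally show "dist (chart_field X\<^sub>0 X c w x) (chart_field X\<^sub>0 X c w y) \<le> L * dist x y"
      by (simp add: dist_norm)
  qed
  define B0 where "B0 = norm (X\<^sub>0 (chart_inv c z) c) + (\<Sum>i\<in>UNIV. C * norm (X i (chart_inv c z) c))"
  have B0: "norm (chart_field X\<^sub>0 X c w z) \<le> B0" if "w \<in> U" for w
    unfolding chart_field_eq B0_def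
    using wi[OF that] by (intro norm_triangle_mono sum_norm_le order_refl) (simp add: mult_right_mono)
  have B0nn: "0 \<le> B0" unfolding B0_def using C by (intro add_nonneg_nonneg sum_nonneg) auto
  show thesis
  proof (rule that[of "B0 + L * \<bar>R\<bar>" L])
    fix w y assume wy: "w \<in> U" "y \<in> cball z R"
    have "norm (chart_field X\<^sub>0 X c w y - chart_field X\<^sub>0 X c w z) \<le> L * dist y z"
      using lipschitz_onD[OF Llip[OF wy(1)] wy(2), of z] wy(2) by (simp add: dist_norm) 
        (metis dist_norm norm_ge_zero order_trans)
    also have "\<dots> \<le> L * \<bar>R\<bar>" using wy(2) Lnn by (intro mult_left_mono) (auto simp: dist_commute)
    finally show "norm (chart_field X\<^sub>0 X c w y) \<le> B0 + L * \<bar>R\<bar>"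
      using B0[OF wy(1)] norm_triangle_sub[of "chart_field X\<^sub>0 X c w y" "chart_field X\<^sub>0 X c w z"] by linarith
  qed (use Lnn B0nn Llip in auto)
qed

section \<open>Solutions of a control-affine system in a chart\<close>

locale control_affine_system =
  fixes A :: "('a::metric_space, 'e::euclidean_space) chart set"
    and X\<^sub>0 :: "('a, 'e) vector_field"
    and X :: "'m::finite \<Rightarrow> ('a, 'e) vector_field"
    and U :: "(real ^ 'm) set"
  assumes atlas: "smooth_atlas A"
    and smooth_drift: "smooth_vector_field A X\<^sub>0"
    and smooth_control_fields: "smooth_vector_field A (X i)"
    and compact_controls: "compact U"
    and convex_controls: "convex U"
    and zero_control: "0 \<in> U"
begin

abbreviation "sol \<equiv> caratheodory_solution A X\<^sub>0 X"
abbreviation "F \<equiv> chart_field X\<^sub>0 X"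

lemma chart: "c \<in> A \<Longrightarrow> is_chart c"
  using atlas by (simp add: smooth_atlas_def)

lemma continuous_solution: "sol u \<xi> \<Longrightarrow> continuous_on S \<xi>"
  by (auto simp: caratheodory_solution_def intro: continuous_on_subset)

lemma solution_has_integral:
  assumes c: "c \<in> A" and \<xi>: "sol u \<xi>" and ab: "a \<le> b" and dom: "\<xi> ` {a..b} \<subseteq> chart_dom c"
  shows "((\<lambda>t. F c (u t) (chart_map c (\<xi> t))) has_integral chart_map c (\<xi> b) - chart_map c (\<xi> a)) {a..b}"
proof -
  have "AE t in lebesgue. \<xi> t \<in> chart_dom c \<longrightarrow>
      ((chart_map c \<circ> \<xi>) has_vector_derivative control_affine_field X\<^sub>0 X (u t) (\<xi> t) c) (at t)"
    using \<xi> c by (simp add: caratheodory_solution_def)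
  then obtain N where N: "N \<in> null_sets lebesgue"
    "{t. \<not> (\<xi> t \<in> chart_dom c \<longrightarrow>
      ((chart_map c \<circ> \<xi>) has_vector_derivative control_affine_field X\<^sub>0 X (u t) (\<xi> t) c) (at t))} \<subseteq> N"
    by (auto simp: eventually_ae_filter)
  have "((\<lambda>t. F c (u t) (chart_map c (\<xi> t))) has_integral (chart_map c \<circ> \<xi>) b - (chart_map c \<circ> \<xi>) a) {a..b}"
  proof (rule absolutely_continuous_has_integral_derivative[OF ab])
    show "absolutely_continuous_on_interval a b (chart_map c \<circ> \<xi>)"
      using \<xi> c dom by (simp add: caratheodory_solution_def)
    show "negligible N" using N by (simp add: negligible_iff_null_sets)
    fix t assume t: "t \<in> {a..b}" "t \<notin> N"
    then have "\<xi> t \<in> chart_dom c" using dom by auto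
    with t N(2) show "((chart_map c \<circ> \<xi>) has_vector_derivative F c (u t) (chart_map c (\<xi> t))) (at t)"
      by (auto simp: chart_field_def is_chart_inverse[OF chart[OF c]])
  qed
  then show ?thesis by simp
qed

lemma solution_displacement:
  assumes c: "c \<in> A" and \<xi>: "sol u \<xi>"
    and dom: "\<And>r. r \<in> closed_segment s t \<Longrightarrow> \<xi> r \<in> chart_dom c"
    and B: "\<And>r. r \<in> closed_segment s t \<Longrightarrow> norm (F c (u r) (chart_map c (\<xi> r))) \<le> B"
  shows "norm (chart_map c (\<xi> t) - chart_map c (\<xi> s)) \<le> B * \<bar>t - s\<bar>"
proof -
  have le: "norm (chart_map c (\<xi> q) - chart_map c (\<xi> p)) \<le> B * (q - p)"
    if pq: "p \<le> q" "{p..q} = closed_segment s t" for p q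
  proof -
    have B0: "0 \<le> B" by (rule order_trans[OF norm_ge_zero B[of s]]) simp
    have "((\<lambda>r. F c (u r) (chart_map c (\<xi> r))) has_integral chart_map c (\<xi> q) - chart_map c (\<xi> p)) {p..q}"
      using pq dom by (intro solution_has_integral[OF c \<xi>]) auto
    from has_integral_bound_real[OF B0 finite.emptyI this]
    have "norm (chart_map c (\<xi> q) - chart_map c (\<xi> p)) \<le> B * measure lborel {p..q}"
      using B pq by simp
    then show ?thesis using pq(1) by simp
  qed
  show ?thesis
    using le[of s t] le[of t s] by (cases "s \<le> t") (auto simp: closed_segment_eq_real_ivl norm_minus_commute)
qed

text \<open>
  If the solution left the ball within time \<open>h\<close>, consider an exit time closest to
  \<open>s\<close>. Up to that time the solution runs in the closed ball, where its speed is at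
  most \<open>B\<close>, so it has moved by less than \<open>R / 2\<close> and is still inside,
  a contradiction. Measuring closeness by \<open>\<bar>r - s\<bar>\<close> treats both time
  directions at once.
\<close>
lemma solution_stays_in_ball:
  assumes c: "c \<in> A" and sub: "cball z R \<subseteq> chart_map c ` chart_dom c"
    and B: "\<And>w y. \<lbrakk>w \<in> U; y \<in> cball z R\<rbrakk> \<Longrightarrow> norm (F c w y) \<le> B"
    and \<xi>: "sol u \<xi>" and u: "\<And>t. u t \<in> U"
    and s: "\<xi> s \<in> chart_dom c" "chart_map c (\<xi> s) \<in> ball z (R / 2)"
    and h: "B * h < R / 2" and B0: "0 \<le> B" and t: "\<bar>t - s\<bar> \<le> h"
  shows "\<xi> t \<in> chart_dom c \<and> chart_map c (\<xi> t) \<in> ball z R"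
proof (rule ccontr)
  assume neg: "\<not> ?thesis"
  define G where "G = {p \<in> chart_dom c. chart_map c p \<in> ball z R}"
  define P where "P = {p \<in> chart_dom c. chart_map c p \<in> cball z R}"
  have G: "open G" unfolding G_def by (rule open_chart_preimage[OF chart[OF c]]) simp
  have P: "closed P" unfolding P_def by (rule closed_chart_preimage_compact[OF chart[OF c] _ sub]) simp
  have GP: "G \<subseteq> P" by (auto simp: G_def P_def)
  have cont: "continuous_on UNIV \<xi>" by (rule continuous_solution[OF \<xi>])
  define Bad where "Bad = {s - h..s + h} \<inter> \<xi> -` (- G)"
  have "closed (\<xi> -` (- G))" using G by (intro closed_vimage cont) auto
  then have "compact Bad" unfolding Bad_def by (intro compact_Int_closed) auto
  moreover have "t \<in> Bad" using neg t by (auto simp: Bad_def G_def abs_le_iff)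
  ultimately obtain \<tau> where \<tau>: "\<tau> \<in> Bad" "\<And>r. r \<in> Bad \<Longrightarrow> \<bar>\<tau> - s\<bar> \<le> \<bar>r - s\<bar>"
    using continuous_attains_inf[of Bad "\<lambda>r. \<bar>r - s\<bar>"] by (force intro: continuous_intros)
  have \<tau>h: "\<bar>\<tau> - s\<bar> \<le> h" using \<tau>(1) by (auto simp: Bad_def abs_le_iff)
  have "R / 2 > 0" using s(2) by (metis ball_eq_empty empty_iff not_le)
  then have sG: "\<xi> s \<in> G" using s by (auto simp: G_def)
  then have ne: "\<tau> \<noteq> s" using \<tau>(1) by (auto simp: Bad_def)
  have inG: "\<xi> r \<in> G" if "r \<in> open_segment s \<tau>" for r
  proof (rule ccontr)
    assume "\<xi> r \<notin> G"
    moreover have lt: "\<bar>r - s\<bar> < \<bar>\<tau> - s\<bar>"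
      using that by (auto simp: open_segment_eq_real_ivl split: if_splits)
    ultimately have "r \<in> Bad" using \<tau>h by (auto simp: Bad_def)
    then show False using \<tau>(2)[of r] lt by linarith
  qed
  have "closed (\<xi> -` P)" by (intro closed_vimage cont P)
  moreover have "open_segment s \<tau> \<subseteq> \<xi> -` P" using inG GP by auto
  ultimately have "closure (open_segment s \<tau>) \<subseteq> \<xi> -` P" by (rule closure_minimal[rotated])
  then have seg: "\<xi> r \<in> P" if "r \<in> closed_segment s \<tau>" for r
    using that ne by (auto simp: closure_open_segment)
  have "norm (chart_map c (\<xi> \<tau>) - chart_map c (\<xi> s)) \<le> B * \<bar>\<tau> - s\<bar>"
    using seg by (intro solution_displacement[OF c \<xi>] B u) (auto simp: P_def)
  also have "\<dots> \<le> B * h" using \<tau>h B0 by (rule mult_left_mono)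
  finally have "dist (chart_map c (\<xi> \<tau>)) (chart_map c (\<xi> s)) < R / 2"
    using h by (simp add: dist_norm)
  then have "chart_map c (\<xi> \<tau>) \<in> ball z R"
    using s(2) dist_triangle_less_add[of z "chart_map c (\<xi> s)" "R/2" "chart_map c (\<xi> \<tau>)" "R/2"]
    by (simp add: dist_commute)
  moreover have "\<xi> \<tau> \<in> chart_dom c" using seg[of \<tau>] by (simp add: P_def)
  ultimately show False using \<tau>(1) by (simp add: Bad_def G_def)
qed

end

section \<open>Continuous dependence on the initial state and the control\<close>

context control_affine_system begin

text \<open>
  Work in a chart around \<open>\<xi> t\<^sub>0\<close> on a time interval so short that
  solutions starting near \<open>\<xi>\<close> cannot leave a fixed ball and that Lipschitz
  constant times length is at most \<open>1/2\<close>. If \<open>M\<close> is the largest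
  distance between the two solutions on the interval, the integral equations give \<open>M \<le>
  M / 2 + o(1)\<close>, so \<open>M\<close> tends to 0. The \<open>o(1)\<close> consists of the
  distance at time \<open>s\<close> and of the weak convergence term.
\<close>
lemma solutions_converge_locally:
  fixes us :: "nat \<Rightarrow> real \<Rightarrow> real ^ 'm"
  assumes um: "u \<in> borel_measurable lebesgue" and usm: "\<And>n. us n \<in> borel_measurable lebesgue"
    and uU: "\<And>t. u t \<in> U" and usU: "\<And>n t. us n t \<in> U"
    and weak: "\<And>p q. (\<lambda>n. integral {p..q} (us n)) \<longlonglongrightarrow> integral {p..q} u"
    and \<xi>: "sol u \<xi>" and \<xi>s: "\<And>n. sol (us n) (\<xi>s n)"
  obtains \<eta> where "0 < \<eta>"
    "\<And>s t. \<lbrakk>\<bar>s - t\<^sub>0\<bar> < \<eta>; \<bar>t - t\<^sub>0\<bar> < \<eta>; (\<lambda>n. \<xi>s n s) \<longlonglongrightarrow> \<xi> s\<rbrakk> \<Longrightarrow> (\<lambda>n. \<xi>s n t) \<longlonglongrightarrow> \<xi> t"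
proof -
  have "\<xi> t\<^sub>0 \<in> (\<Union>c\<in>A. chart_dom c)"
    using atlas by (simp add: smooth_atlas_def)
  then obtain c where c: "c \<in> A" "\<xi> t\<^sub>0 \<in> chart_dom c" by blast
  note chc = chart[OF c(1)]
  let ?z = "\<lambda>t. chart_map c (\<xi> t)" and ?zs = "\<lambda>n t. chart_map c (\<xi>s n t)"
  have "open (chart_map c ` chart_dom c)" using chc by (simp add: is_chart_def)
  then obtain R where R: "0 < R" "cball (?z t\<^sub>0) R \<subseteq> chart_map c ` chart_dom c"
    using c(2) by (meson imageI open_contains_cball)
  define K where "K = cball (?z t\<^sub>0) R"
  have bU: "bounded U" by (rule compact_imp_bounded[OF compact_controls])
  then obtain C where C: "\<And>w. w \<in> U \<Longrightarrow> norm w \<le> C" by (auto simp: bounded_iff)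
  obtain B L where B0: "0 \<le> B" and L0: "0 \<le> L"
    and B: "\<And>w y. \<lbrakk>w \<in> U; y \<in> K\<rbrakk> \<Longrightarrow> norm (F c w y) \<le> B"
    and L: "\<And>w. w \<in> U \<Longrightarrow> L-lipschitz_on K (F c w)"
    unfolding K_def
    by (rule chart_field_bounded_lipschitz_on_cball[where X = X, OF smooth_drift smooth_control_fields c(1) bU R(2)]) blast
  have XK: "continuous_on K (\<lambda>y. X i (chart_inv c y) c)" for i
  proof -
    have "smooth_on (chart_map c ` chart_dom c) (\<lambda>y. X i (chart_inv c y) c)"
      using smooth_control_fields c(1) by (simp add: smooth_vector_field_def)
    then have "Ck_on 0 (chart_map c ` chart_dom c) (\<lambda>y. X i (chart_inv c y) c)"
      unfolding smooth_on_def by blast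
    then show ?thesis using R(2) by (auto simp: K_def intro: continuous_on_subset)
  qed
  define G where "G = {p \<in> chart_dom c. chart_map c p \<in> ball (?z t\<^sub>0) (R / 2)}"
  have G: "open G" unfolding G_def by (rule open_chart_preimage[OF chc]) simp
  have "open (\<xi> -` G)" using G continuous_solution[OF \<xi>] by (rule open_vimage)
  moreover have "t\<^sub>0 \<in> \<xi> -` G" using c(2) R(1) by (simp add: G_def)
  ultimately obtain \<eta>0 where \<eta>0: "0 < \<eta>0" "cball t\<^sub>0 \<eta>0 \<subseteq> \<xi> -` G" by (meson open_contains_cball)
  \<comment> \<open>two times in the interval differ by up to \<open>2 * \<eta>\<close>: the second bound keeps solutions in the ball,
     the third makes the integral equation contract\<close>
  define \<eta> where "\<eta> = min \<eta>0 (min (R / (8 * (B + 1))) (1 / (4 * (L + 1))))"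
  have \<eta>: "0 < \<eta>" "\<eta> \<le> \<eta>0" using R(1) B0 L0 \<eta>0(1) by (auto simp: \<eta>_def)
  have B\<eta>: "B * (2 * \<eta>) < R / 2"
  proof -
    have "\<eta> \<le> R / (8 * (B + 1))" by (simp add: \<eta>_def)
    then have "\<eta> * (8 * (B + 1)) \<le> R" using B0 by (simp add: pos_le_divide_eq)
    then show ?thesis using \<eta>(1) R(1) by (simp add: algebra_simps)
  qed
  have L\<eta>: "L * (2 * \<eta>) \<le> 1 / 2"
  proof -
    have "\<eta> \<le> 1 / (4 * (L + 1))" by (simp add: \<eta>_def)
    then have "\<eta> * (4 * (L + 1)) \<le> 1" using L0 by (simp add: pos_le_divide_eq)
    then show ?thesis using \<eta>(1) by (simp add: algebra_simps)
  qed
  define a b where "a = t\<^sub>0 - \<eta>" and "b = t\<^sub>0 + \<eta>"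
  have \<xi>G: "\<xi> t \<in> chart_dom c" "?z t \<in> ball (?z t\<^sub>0) (R / 2)" "?z t \<in> K" if "t \<in> {a..b}" for t
  proof -
    have "t \<in> cball t\<^sub>0 \<eta>0" using that \<eta>(2) by (auto simp: a_def b_def dist_real_def abs_le_iff)
    then have "\<xi> t \<in> G" using \<eta>0(2) by auto
    then show "\<xi> t \<in> chart_dom c" "?z t \<in> ball (?z t\<^sub>0) (R / 2)" "?z t \<in> K"
      using R(1) by (auto simp: G_def K_def)
  qed
  have cmap: "continuous_on (chart_dom c) (chart_map c)"
    using chc by (auto simp: is_chart_def homeomorphism_def)
  have cz: "continuous_on {a..b} ?z"
    by (rule continuous_on_compose2[OF cmap continuous_solution[OF \<xi>]]) (use \<xi>G in auto)
  have cX: "continuous_on {a..b} (\<lambda>t. X i (\<xi> t) c)" for i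
  proof -
    have "continuous_on {a..b} (\<lambda>t. X i (chart_inv c (?z t)) c)"
      by (rule continuous_on_compose2[OF XK cz]) (use \<xi>G in auto)
    then show ?thesis
      by (rule continuous_on_eq) (simp add: is_chart_inverse[OF chc] \<xi>G)
  qed
  have conv: "(\<lambda>n. \<xi>s n t) \<longlonglongrightarrow> \<xi> t"
    if s: "s \<in> {a..b}" and lim: "(\<lambda>n. \<xi>s n s) \<longlonglongrightarrow> \<xi> s" and t: "t \<in> {a..b}" for s t
  proof -
    have "\<forall>\<^sub>F n in sequentially. \<xi>s n s \<in> G"
      using topological_tendstoD[OF lim G] \<xi>G[OF s] by (simp add: G_def)
    then have inK: "\<forall>\<^sub>F n in sequentially. \<forall>t\<in>{a..b}. \<xi>s n t \<in> chart_dom c \<and> ?zs n t \<in> K"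
    proof eventually_elim
      case (elim n)
      show ?case
      proof
        fix t assume t: "t \<in> {a..b}"
        have "\<bar>t - s\<bar> \<le> 2 * \<eta>" using s t by (auto simp: a_def b_def abs_le_iff)
        then have "\<xi>s n t \<in> chart_dom c \<and> ?zs n t \<in> ball (?z t\<^sub>0) R"
          using elim B unfolding K_def G_def
          by (intro solution_stays_in_ball[OF c(1) R(2) _ \<xi>s usU _ _ B\<eta> B0]) auto
        then show "\<xi>s n t \<in> chart_dom c \<and> ?zs n t \<in> K" by (auto simp: K_def)
      qed
    qed
    have indom: "\<forall>\<^sub>F n in sequentially. \<xi>s n t \<in> chart_dom c" if "t \<in> {a..b}" for t
      using inK by eventually_elim (use that in auto)
    have lims: "(\<lambda>n. ?zs n s) \<longlonglongrightarrow> ?z s"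
      using lim tendsto_iff_chart[OF chc \<xi>G(1)[OF s] indom[OF s]] by simp
    let ?d = "\<lambda>n t. ?zs n t - ?z t"
    let ?Q = "\<lambda>n \<tau>. \<Sum>i\<in>UNIV. (us n \<tau> $ i - u \<tau> $ i) *\<^sub>R X i (\<xi> \<tau>) c"
    have "(\<lambda>n. ?zs n t) \<longlonglongrightarrow> ?z t"
    proof (rule tendstoI)
      fix \<epsilon> :: real assume \<epsilon>: "0 < \<epsilon>"
      have e4: "0 < \<epsilon> / 5" using \<epsilon> by simp
      have "\<forall>\<^sub>F n in sequentially. dist (?zs n s) (?z s) < \<epsilon> / 5"
        by (rule tendstoD[OF lims e4])
      moreover note weak_limit_linear_combination[where g = "\<lambda>i t. X i (\<xi> t) c", OF um usm C[OF uU] C[OF usU] weak cX e4]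
      ultimately show "\<forall>\<^sub>F n in sequentially. dist (?zs n t) (?z t) < \<epsilon>"
        using inK
      proof eventually_elim
        case (elim n)
        have "continuous_on {a..b} (?zs n)"
          by (rule continuous_on_compose2[OF cmap continuous_solution[OF \<xi>s]]) (use elim in auto)
        then have "continuous_on {a..b} (\<lambda>t. norm (?d n t))"
          by (intro continuous_intros cz)
        then obtain m where m: "m \<in> {a..b}" "\<And>t. t \<in> {a..b} \<Longrightarrow> norm (?d n t) \<le> norm (?d n m)"
          using continuous_attains_sup[of "{a..b}" "\<lambda>t. norm (?d n t)"] s by fastforce
        define M where "M = norm (?d n m)"
        have M: "norm (?d n t) \<le> M" if "t \<in> {a..b}" for t using m(2)[OF that] by (simp add: M_def)
        have step: "norm (?d n q - ?d n p) \<le> L * M * (q - p) + \<epsilon> / 5"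
          if pq: "a \<le> p" "p \<le> q" "q \<le> b" for p q
        proof -
          have sub: "\<tau> \<in> {a..b}" if "\<tau> \<in> {p..q}" for \<tau> using that pq by auto
          have "((\<lambda>\<tau>. F c (us n \<tau>) (?zs n \<tau>)) has_integral ?zs n q - ?zs n p) {p..q}"
            using sub elim(3) by (intro solution_has_integral[OF c(1) \<xi>s pq(2)]) auto
          moreover have "((\<lambda>\<tau>. F c (u \<tau>) (?z \<tau>)) has_integral ?z q - ?z p) {p..q}"
            using sub \<xi>G(1) by (intro solution_has_integral[OF c(1) \<xi> pq(2)]) auto
          moreover have Qi: "?Q n integrable_on {p..q}" "norm (integral {p..q} (?Q n)) \<le> \<epsilon> / 5"
            using elim(2) pq by auto
          ultimately have "((\<lambda>\<tau>. F c (us n \<tau>) (?zs n \<tau>) - F c (u \<tau>) (?z \<tau>) - ?Q n \<tau>) has_integral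
              (?zs n q - ?zs n p) - (?z q - ?z p) - integral {p..q} (?Q n)) {p..q}"
            by (intro has_integral_diff integrable_integral)
          moreover have "F c (us n \<tau>) (?zs n \<tau>) - F c (u \<tau>) (?z \<tau>) - ?Q n \<tau>
              = F c (us n \<tau>) (?zs n \<tau>) - F c (us n \<tau>) (?z \<tau>)" if "\<tau> \<in> {p..q}" for \<tau>
            using \<xi>G(1)[OF sub[OF that]]
            by (simp add: chart_field_eq is_chart_inverse[OF chc] scaleR_diff_left sum_subtractf)
          ultimately have int: "((\<lambda>\<tau>. F c (us n \<tau>) (?zs n \<tau>) - F c (us n \<tau>) (?z \<tau>)) has_integral
              (?zs n q - ?zs n p) - (?z q - ?z p) - integral {p..q} (?Q n)) {p..q}"
            by (rule has_integral_eq[rotated])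
          have bnd: "norm (F c (us n \<tau>) (?zs n \<tau>) - F c (us n \<tau>) (?z \<tau>)) \<le> L * M" if "\<tau> \<in> {p..q}" for \<tau>
          proof -
            have "norm (F c (us n \<tau>) (?zs n \<tau>) - F c (us n \<tau>) (?z \<tau>)) \<le> L * norm (?d n \<tau>)"
              using lipschitz_onD[OF L[OF usU], of "?zs n \<tau>" "?z \<tau>" n \<tau>] elim(3) \<xi>G(3) sub[OF that]
              by (simp add: dist_norm)
            also have "\<dots> \<le> L * M" using M sub[OF that] L0 by (intro mult_left_mono) auto
            finally show ?thesis .
          qed
          have LM: "0 \<le> L * M" using L0 by (simp add: M_def)
          have "norm ((?zs n q - ?zs n p) - (?z q - ?z p) - integral {p..q} (?Q n)) \<le> L * M * measure lborel {p..q}"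
            by (rule has_integral_bound_real[OF LM finite.emptyI int]) (use bnd in auto)
          then have le: "norm ((?zs n q - ?zs n p) - (?z q - ?z p) - integral {p..q} (?Q n)) \<le> L * M * (q - p)"
            using pq(2) by simp
          have eq: "?d n q - ?d n p = ((?zs n q - ?zs n p) - (?z q - ?z p) - integral {p..q} (?Q n)) + integral {p..q} (?Q n)"
            by simp
          show ?thesis unfolding eq by (rule norm_triangle_mono[OF le Qi(2)])
        qed
        have "norm (?d n t - ?d n s) \<le> M / 2 + \<epsilon> / 5" if t: "t \<in> {a..b}" for t
        proof -
          have le: "norm (?d n q - ?d n p) \<le> M / 2 + \<epsilon> / 5" if "a \<le> p" "p \<le> q" "q \<le> b" for p q
          proof -
            have "L * M * (q - p) \<le> L * M * (2 * \<eta>)"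
              using that L0 by (intro mult_left_mono) (auto simp: a_def b_def M_def)
            also have "\<dots> = L * (2 * \<eta>) * M" by simp
            also have "\<dots> \<le> 1 / 2 * M" using L\<eta> by (rule mult_right_mono) (simp add: M_def)
            finally show ?thesis using step[OF that] by simp
          qed
          show ?thesis
            using le[of s t] le[of t s] s t norm_minus_commute[of "?d n t" "?d n s"]
            by (cases "s \<le> t") auto
        qed
        then have main: "norm (?d n t) \<le> M / 2 + 2 * (\<epsilon> / 5)" if "t \<in> {a..b}" for t
          using that elim(1) norm_triangle_sub[of "?d n t" "?d n s"] unfolding dist_norm by fastforce
        then have "M \<le> M / 2 + 2 * (\<epsilon> / 5)" using m(1) unfolding M_def by blast
        then show ?case using main[OF t] \<epsilon> by (simp add: dist_norm)
      qed
    qed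
    then show ?thesis using tendsto_iff_chart[OF chc \<xi>G(1)[OF t] indom[OF t]] by simp
  qed
  show thesis
  proof (rule that[OF \<eta>(1)])
    fix s t assume "\<bar>s - t\<^sub>0\<bar> < \<eta>" "\<bar>t - t\<^sub>0\<bar> < \<eta>" "(\<lambda>n. \<xi>s n s) \<longlonglongrightarrow> \<xi> s"
    then show "(\<lambda>n. \<xi>s n t) \<longlonglongrightarrow> \<xi> t"
      by (intro conv[of s t]) (auto simp: a_def b_def abs_less_iff)
  qed
qed

text \<open>
  The local lemma says that near each time either all times or no times belong to the set of
  times of convergence. This set is thus open and closed, and it contains \<open>s\<close>.
\<close>
lemma solutions_converge:
  fixes us :: "nat \<Rightarrow> real \<Rightarrow> real ^ 'm"
  assumes um: "u \<in> borel_measurable lebesgue" and usm: "\<And>n. us n \<in> borel_measurable lebesgue"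
    and uU: "\<And>t. u t \<in> U" and usU: "\<And>n t. us n t \<in> U"
    and weak: "\<And>p q. (\<lambda>n. integral {p..q} (us n)) \<longlonglongrightarrow> integral {p..q} u"
    and \<xi>: "sol u \<xi>" and \<xi>s: "\<And>n. sol (us n) (\<xi>s n)"
    and init: "(\<lambda>n. \<xi>s n s) \<longlonglongrightarrow> \<xi> s"
  shows "(\<lambda>n. \<xi>s n t) \<longlonglongrightarrow> \<xi> t"
proof -
  define T where "T = {t. (\<lambda>n. \<xi>s n t) \<longlonglongrightarrow> \<xi> t}"
  have nbhd: "\<exists>\<eta>>0. ball t\<^sub>0 \<eta> \<subseteq> T \<or> ball t\<^sub>0 \<eta> \<subseteq> - T" for t\<^sub>0
  proof -
    obtain \<eta> where \<eta>: "0 < \<eta>"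
      "\<And>s t. \<lbrakk>\<bar>s - t\<^sub>0\<bar> < \<eta>; \<bar>t - t\<^sub>0\<bar> < \<eta>; (\<lambda>n. \<xi>s n s) \<longlonglongrightarrow> \<xi> s\<rbrakk> \<Longrightarrow> (\<lambda>n. \<xi>s n t) \<longlonglongrightarrow> \<xi> t"
      by (rule solutions_converge_locally[OF um usm uU usU weak \<xi> \<xi>s, of t\<^sub>0]) blast
    show ?thesis
    proof (intro exI[of _ \<eta>] conjI)
      show "ball t\<^sub>0 \<eta> \<subseteq> T \<or> ball t\<^sub>0 \<eta> \<subseteq> - T"
        using \<eta>(2) by (auto simp: T_def dist_real_def abs_minus_commute subset_iff)
    qed (rule \<eta>(1))
  qed
  have "open T"
    unfolding open_contains_ball
  proof
    fix t assume "t \<in> T"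
    with nbhd[of t] show "\<exists>e>0. ball t e \<subseteq> T"
      by (metis ComplD centre_in_ball subsetD)
  qed
  moreover have "open (- T)"
    unfolding open_contains_ball
  proof
    fix t assume "t \<in> - T"
    with nbhd[of t] show "\<exists>e>0. ball t e \<subseteq> - T"
      by (metis ComplD centre_in_ball subsetD)
  qed
  ultimately have "T = {} \<or> T = UNIV" using clopen closed_def by blast
  then show ?thesis using init by (auto simp: T_def)
qed

end

section \<open>Translation and concatenation of solutions\<close>

lemma AE_lebesgue_translate:
  fixes P :: "real \<Rightarrow> bool"
  assumes "AE t in lebesgue. P t"
  shows "AE t in lebesgue. P (t + s)"
proof -
  obtain N where N: "negligible N" "{t. \<not> P t} \<subseteq> N"
    using assms by (auto simp: eventually_ae_filter negligible_iff_null_sets)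
  have "{t. \<not> P (t + s)} \<subseteq> (+) (- s) ` N"
    using N(2) by (force simp: image_iff)
  then show ?thesis
    using negligible_translation[OF N(1), of "- s"] by (auto simp: eventually_ae_filter negligible_iff_null_sets)
qed

lemma lebesgue_measurable_translate:
  fixes f :: "real \<Rightarrow> 'v::euclidean_space"
  assumes "f \<in> borel_measurable lebesgue"
  shows "(\<lambda>t. f (t + s)) \<in> borel_measurable lebesgue"
proof -
  have "(\<lambda>t::real. s + (\<Sum>j\<in>Basis. (1 * (t \<bullet> j)) *\<^sub>R j)) \<in> lebesgue \<rightarrow>\<^sub>M lebesgue"
    by (rule lebesgue_affine_measurable) simp
  then have "(\<lambda>t. t + s) \<in> lebesgue \<rightarrow>\<^sub>M (lebesgue :: real measure)"
    by (simp add: add.commute)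
  then show ?thesis by (rule measurable_compose[OF _ assms])
qed

text \<open>
  With bounded controls the solutions are locally Lipschitz in charts, and the Lipschitz
  property passes to translations and concatenations without handling divisions.
\<close>
lemma lipschitz_on_absolutely_continuous:
  fixes f :: "real \<Rightarrow> 'e::euclidean_space"
  assumes f: "B-lipschitz_on {a..b} f"
  shows "absolutely_continuous_on_interval a b f"
  unfolding absolutely_continuous_on_interval_def
proof (intro allI impI)
  fix \<epsilon> :: real assume \<epsilon>: "0 < \<epsilon>"
  have B: "0 \<le> B" using f lipschitz_on_nonneg by blast
  show "\<exists>\<delta>>0. \<forall>D. D division_of \<Union>D \<and> \<Union>D \<subseteq> {a..b} \<and> (\<Sum>K\<in>D. Sup K - Inf K) < \<delta> \<longrightarrow>
      (\<Sum>K\<in>D. norm (f (Sup K) - f (Inf K))) < \<epsilon>"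
  proof (intro exI[of _ "\<epsilon> / (B + 1)"] conjI allI impI)
    show "0 < \<epsilon> / (B + 1)" using \<epsilon> B by simp
    fix D :: "real set set"
    assume D: "D division_of \<Union>D \<and> \<Union>D \<subseteq> {a..b} \<and> (\<Sum>K\<in>D. Sup K - Inf K) < \<epsilon> / (B + 1)"
    have K: "Inf K \<in> {a..b} \<and> Sup K \<in> {a..b} \<and> Inf K \<le> Sup K" if KD: "K \<in> D" for K
    proof -
      have div: "D division_of \<Union>D" using D by blast
      obtain p q where "K = cbox p q" using division_ofD(4)[OF div KD] by blast
      moreover have "K \<noteq> {}" by (rule division_ofD(3)[OF div KD])
      moreover have "K \<subseteq> {a..b}" using D KD by blast
      ultimately show ?thesis by auto
    qed
    have "(\<Sum>K\<in>D. norm (f (Sup K) - f (Inf K))) \<le> (\<Sum>K\<in>D. B * (Sup K - Inf K))"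
      using K lipschitz_onD[OF f] by (intro sum_mono) (fastforce simp: dist_norm)
    also have "\<dots> = B * (\<Sum>K\<in>D. Sup K - Inf K)" by (simp add: sum_distrib_left)
    also have "\<dots> \<le> B * (\<epsilon> / (B + 1))" using D B by (intro mult_left_mono) auto
    also have "\<dots> < \<epsilon>" using \<epsilon> B by (simp add: field_simps)
    finally show "(\<Sum>K\<in>D. norm (f (Sup K) - f (Inf K))) < \<epsilon>" .
  qed
qed

context control_affine_system begin

lemma solution_lipschitz_in_chart:
  assumes c: "c \<in> A" and \<xi>: "sol u \<xi>" and u: "\<And>t. u t \<in> U" and dom: "\<xi> ` {a..b} \<subseteq> chart_dom c"
  obtains B where "B-lipschitz_on {a..b} (chart_map c \<circ> \<xi>)"
proof -
  note chc = chart[OF c]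
  obtain C where C: "\<And>w. w \<in> U \<Longrightarrow> norm w \<le> C"
    using compact_imp_bounded[OF compact_controls] by (auto simp: bounded_iff)
  have C0: "0 \<le> C" using C[OF zero_control] by simp
  have cmap: "continuous_on (chart_dom c) (chart_map c)"
    using chc by (auto simp: is_chart_def homeomorphism_def)
  have cz: "continuous_on {a..b} (\<lambda>t. chart_map c (\<xi> t))"
    by (rule continuous_on_compose2[OF cmap continuous_solution[OF \<xi>] dom])
  have bnd: "\<exists>D. \<forall>t\<in>{a..b}. norm (Y (\<xi> t) c) \<le> D" if Y: "smooth_vector_field A Y" for Y
  proof -
    have "smooth_on (chart_map c ` chart_dom c) (\<lambda>y. Y (chart_inv c y) c)"
      using Y c by (simp add: smooth_vector_field_def)
    then have "Ck_on 0 (chart_map c ` chart_dom c) (\<lambda>y. Y (chart_inv c y) c)"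
      unfolding smooth_on_def by blast
    then have "continuous_on (chart_map c ` chart_dom c) (\<lambda>y. Y (chart_inv c y) c)" by simp
    then have "continuous_on {a..b} (\<lambda>t. Y (chart_inv c (chart_map c (\<xi> t))) c)"
      by (rule continuous_on_compose2[OF _ cz]) (use dom in auto)
    then have "bounded ((\<lambda>t. Y (chart_inv c (chart_map c (\<xi> t))) c) ` {a..b})"
      by (intro compact_imp_bounded compact_continuous_image) auto
    then obtain D where D: "\<And>t. t \<in> {a..b} \<Longrightarrow> norm (Y (chart_inv c (chart_map c (\<xi> t))) c) \<le> D"
      by (force simp: bounded_iff)
    have "norm (Y (\<xi> t) c) \<le> D" if "t \<in> {a..b}" for t
    proof -
      have "\<xi> t \<in> chart_dom c" using dom that by blast
      then show ?thesis using D[OF that] by (simp add: is_chart_inverse[OF chc])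
    qed
    then show ?thesis by blast
  qed
  obtain D0 where D0: "\<And>t. t \<in> {a..b} \<Longrightarrow> norm (X\<^sub>0 (\<xi> t) c) \<le> D0" using bnd[OF smooth_drift] by blast
  obtain Di where Di: "\<And>i t. t \<in> {a..b} \<Longrightarrow> norm (X i (\<xi> t) c) \<le> Di i" using bnd[OF smooth_control_fields] by metis
  define B where "B = \<bar>D0\<bar> + (\<Sum>i\<in>UNIV. C * \<bar>Di i\<bar>)"
  have B0: "0 \<le> B" unfolding B_def using C0 by (intro add_nonneg_nonneg sum_nonneg) auto
  have FB: "norm (F c (u t) (chart_map c (\<xi> t))) \<le> B" if t: "t \<in> {a..b}" for t
  proof -
    have "\<xi> t \<in> chart_dom c" using dom t by auto
    then have "F c (u t) (chart_map c (\<xi> t)) = X\<^sub>0 (\<xi> t) c + (\<Sum>i\<in>UNIV. (u t $ i) *\<^sub>R X i (\<xi> t) c)"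
      by (simp add: chart_field_eq is_chart_inverse[OF chc])
    also have "norm \<dots> \<le> B"
      unfolding B_def
    proof (intro norm_triangle_mono sum_norm_le)
      show "norm (X\<^sub>0 (\<xi> t) c) \<le> \<bar>D0\<bar>" using D0[OF t] by linarith
      fix i
      have "\<bar>u t $ i\<bar> \<le> C" using C[OF u, of t] component_le_norm_cart[of "u t" i] by linarith
      moreover have "norm (X i (\<xi> t) c) \<le> \<bar>Di i\<bar>" using Di[OF t, of i] by linarith
      ultimately show "norm ((u t $ i) *\<^sub>R X i (\<xi> t) c) \<le> C * \<bar>Di i\<bar>"
        using C0 by (auto intro!: mult_mono)
    qed
    finally show ?thesis .
  qed
  have "B-lipschitz_on {a..b} (chart_map c \<circ> \<xi>)"
  proof (rule lipschitz_onI[OF _ B0])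
    fix s t assume st: "s \<in> {a..b}" "t \<in> {a..b}"
    have sub: "closed_segment t s \<subseteq> {a..b}" using st by (auto simp: closed_segment_eq_real_ivl split: if_splits)
    have "norm (chart_map c (\<xi> s) - chart_map c (\<xi> t)) \<le> B * \<bar>s - t\<bar>"
      using sub dom FB by (intro solution_displacement[OF c \<xi>]) blast+
    then show "dist ((chart_map c \<circ> \<xi>) s) ((chart_map c \<circ> \<xi>) t) \<le> B * dist s t"
      by (simp add: dist_norm)
  qed
  then show thesis by (rule that)
qed

text \<open>
  Only the class of a control modulo null sets matters; this allows replacing controls by
  \<open>U\<close>-valued representatives.
\<close>
lemma solution_cong_AE:
  assumes \<xi>: "sol u \<xi>" and uv: "AE t in lebesgue. u t = v t"
  shows "sol v \<xi>"
  unfolding caratheodory_solution_def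
proof (intro conjI ballI allI impI)
  fix c assume c: "c \<in> A"
  have "AE t in lebesgue. \<xi> t \<in> chart_dom c \<longrightarrow>
      ((chart_map c \<circ> \<xi>) has_vector_derivative control_affine_field X\<^sub>0 X (u t) (\<xi> t) c) (at t)"
    using \<xi> c by (simp add: caratheodory_solution_def)
  then show "AE t in lebesgue. \<xi> t \<in> chart_dom c \<longrightarrow>
      ((chart_map c \<circ> \<xi>) has_vector_derivative control_affine_field X\<^sub>0 X (v t) (\<xi> t) c) (at t)"
    using uv by eventually_elim auto
qed (use \<xi> in \<open>auto simp: caratheodory_solution_def\<close>)

lemma solution_shift:
  assumes \<xi>: "sol u \<xi>" and u: "\<And>t. u t \<in> U"
  shows "sol (\<lambda>t. u (t + s)) (\<lambda>t. \<xi> (t + s))"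
  unfolding caratheodory_solution_def
proof (intro conjI ballI allI impI)
  show "continuous_on UNIV (\<lambda>t. \<xi> (t + s))"
    by (rule continuous_on_compose2[OF continuous_solution[OF \<xi>, of UNIV]]) (auto intro!: continuous_intros)
  fix c assume c: "c \<in> A"
  show "absolutely_continuous_on_interval a b (chart_map c \<circ> (\<lambda>t. \<xi> (t + s)))"
    if dom: "(\<lambda>t. \<xi> (t + s)) ` {a..b} \<subseteq> chart_dom c" for a b
  proof -
    have "\<xi> ` {a + s..b + s} \<subseteq> chart_dom c"
    proof
      fix p assume "p \<in> \<xi> ` {a + s..b + s}"
      then obtain r where "r \<in> {a + s..b + s}" "p = \<xi> r" by auto
      then have "r - s \<in> {a..b}" "p = (\<lambda>t. \<xi> (t + s)) (r - s)" by auto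
      then show "p \<in> chart_dom c" using dom by blast
    qed
    then obtain B where B: "B-lipschitz_on {a + s..b + s} (chart_map c \<circ> \<xi>)"
      by (rule solution_lipschitz_in_chart[OF c \<xi> u])
    have "B-lipschitz_on {a..b} (chart_map c \<circ> (\<lambda>t. \<xi> (t + s)))"
    proof (rule lipschitz_onI)
      fix p q assume "p \<in> {a..b}" "q \<in> {a..b}"
      then show "dist ((chart_map c \<circ> (\<lambda>t. \<xi> (t + s))) p) ((chart_map c \<circ> (\<lambda>t. \<xi> (t + s))) q) \<le> B * dist p q"
        using lipschitz_onD[OF B, of "p + s" "q + s"] by (simp add: dist_real_def)
    qed (rule lipschitz_on_nonneg[OF B])
    then show ?thesis by (rule lipschitz_on_absolutely_continuous)
  qed
  have "AE t in lebesgue. \<xi> t \<in> chart_dom c \<longrightarrow>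
      ((chart_map c \<circ> \<xi>) has_vector_derivative control_affine_field X\<^sub>0 X (u t) (\<xi> t) c) (at t)"
    using \<xi> c by (simp add: caratheodory_solution_def)
  from AE_lebesgue_translate[OF this, of s]
  show "AE t in lebesgue. \<xi> (t + s) \<in> chart_dom c \<longrightarrow>
      ((chart_map c \<circ> (\<lambda>t. \<xi> (t + s))) has_vector_derivative
        control_affine_field X\<^sub>0 X (u (t + s)) (\<xi> (t + s)) c) (at t)"
  proof eventually_elim
    case (elim t)
    have sh: "((\<lambda>t. t + s) has_vector_derivative 1) (at t)" by (auto intro!: derivative_eq_intros)
    show ?case
    proof
      assume "\<xi> (t + s) \<in> chart_dom c"
      with elim have "((chart_map c \<circ> \<xi>) has_vector_derivative
          control_affine_field X\<^sub>0 X (u (t + s)) (\<xi> (t + s)) c) (at (t + s))" by simp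
      from vector_diff_chain_at[OF sh this]
      show "((chart_map c \<circ> (\<lambda>t. \<xi> (t + s))) has_vector_derivative
        control_affine_field X\<^sub>0 X (u (t + s)) (\<xi> (t + s)) c) (at t)"
        by (simp add: o_def)
    qed
  qed
qed

lemma solution_concat:
  assumes \<xi>: "sol u \<xi>" and \<zeta>: "sol v \<zeta>" and u: "\<And>t. u t \<in> U" and v: "\<And>t. v t \<in> U"
    and eq: "\<xi> s = \<zeta> s"
  shows "sol (\<lambda>t. if t \<le> s then u t else v t) (\<lambda>t. if t \<le> s then \<xi> t else \<zeta> t)"
    (is "sol ?w ?\<chi>")
  unfolding caratheodory_solution_def
proof (intro conjI ballI allI impI)
  have un: "UNIV = {..s} \<union> {s..}" by auto
  show "continuous_on UNIV ?\<chi>"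
    unfolding un using eq continuous_solution[OF \<xi>] continuous_solution[OF \<zeta>]
    by (intro continuous_on_If) auto
  fix c assume c: "c \<in> A"
  show "absolutely_continuous_on_interval a b (chart_map c \<circ> ?\<chi>)"
    if dom: "?\<chi> ` {a..b} \<subseteq> chart_dom c" for a b
  proof -
    have d1: "\<xi> ` {a..min b s} \<subseteq> chart_dom c" using dom by force
    have d2: "\<zeta> ` {max a s..b} \<subseteq> chart_dom c"
    proof
      fix p assume "p \<in> \<zeta> ` {max a s..b}"
      then obtain r where r: "r \<in> {max a s..b}" "p = \<zeta> r" by auto
      then have "p = ?\<chi> r" "r \<in> {a..b}" using eq by auto
      then show "p \<in> chart_dom c" using dom by blast
    qed
    obtain B1 where B1: "B1-lipschitz_on {a..min b s} (chart_map c \<circ> \<xi>)"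
      by (rule solution_lipschitz_in_chart[OF c \<xi> u d1])
    obtain B2 where B2: "B2-lipschitz_on {max a s..b} (chart_map c \<circ> \<zeta>)"
      by (rule solution_lipschitz_in_chart[OF c \<zeta> v d2])
    consider "b \<le> s" | "s < a" | "a \<le> s" "s < b" by linarith
    then have "\<exists>B. B-lipschitz_on {a..b} (chart_map c \<circ> ?\<chi>)"
    proof cases
      case 1
      then have "B1-lipschitz_on {a..b} (chart_map c \<circ> ?\<chi>)"
        using B1 by (simp add: min_def lipschitz_on_def)
      then show ?thesis by blast
    next
      case 2
      then have "B2-lipschitz_on {a..b} (chart_map c \<circ> ?\<chi>)"
        using B2 by (simp add: max_def lipschitz_on_def)
      then show ?thesis by blast
    next
      case 3
      have "(max B1 B2)-lipschitz_on {a..b} (\<lambda>t. if t \<le> s then (chart_map c \<circ> \<xi>) t else (chart_map c \<circ> \<zeta>) t)"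
        using B1 B2 3 eq by (intro lipschitz_on_concat_max) (auto simp: min_def max_def)
      moreover have "chart_map c \<circ> ?\<chi> = (\<lambda>t. if t \<le> s then (chart_map c \<circ> \<xi>) t else (chart_map c \<circ> \<zeta>) t)"
        by auto
      ultimately show ?thesis by metis
    qed
    then show ?thesis using lipschitz_on_absolutely_continuous by blast
  qed
  have "AE t in lebesgue. \<xi> t \<in> chart_dom c \<longrightarrow>
      ((chart_map c \<circ> \<xi>) has_vector_derivative control_affine_field X\<^sub>0 X (u t) (\<xi> t) c) (at t)"
    "AE t in lebesgue. \<zeta> t \<in> chart_dom c \<longrightarrow>
      ((chart_map c \<circ> \<zeta>) has_vector_derivative control_affine_field X\<^sub>0 X (v t) (\<zeta> t) c) (at t)"
    using \<xi> \<zeta> c by (simp_all add: caratheodory_solution_def)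
  moreover have "AE t in lebesgue. t \<noteq> s"
    by (intro AE_I'[of "{s}"]) (auto simp flip: negligible_iff_null_sets)
  ultimately show "AE t in lebesgue. ?\<chi> t \<in> chart_dom c \<longrightarrow>
      ((chart_map c \<circ> ?\<chi>) has_vector_derivative control_affine_field X\<^sub>0 X (?w t) (?\<chi> t) c) (at t)"
  proof eventually_elim
    case (elim t)
    show ?case
    proof (cases "t < s")
      case True
      show ?thesis
      proof
        assume "?\<chi> t \<in> chart_dom c"
        then have "((chart_map c \<circ> \<xi>) has_vector_derivative control_affine_field X\<^sub>0 X (?w t) (?\<chi> t) c) (at t)"
          using elim True by simp
        then show "((chart_map c \<circ> ?\<chi>) has_vector_derivative control_affine_field X\<^sub>0 X (?w t) (?\<chi> t) c) (at t)"
          by (rule has_vector_derivative_transform_within_open[of _ _ _ "{..<s}"]) (use True in auto)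
      qed
    next
      case False
      then have gt: "s < t" using elim by simp
      show ?thesis
      proof
        assume "?\<chi> t \<in> chart_dom c"
        then have "((chart_map c \<circ> \<zeta>) has_vector_derivative control_affine_field X\<^sub>0 X (?w t) (?\<chi> t) c) (at t)"
          using elim gt by simp
        then show "((chart_map c \<circ> ?\<chi>) has_vector_derivative control_affine_field X\<^sub>0 X (?w t) (?\<chi> t) c) (at t)"
          by (rule has_vector_derivative_transform_within_open[of _ _ _ "{s<..}"]) (use gt in auto)
      qed
    qed
  qed
qed

end

section \<open>Chain controllability in an abstract control flow\<close>

text \<open>
  The properties of the solution map on which the chain arguments rest. In
  \<open>sequentially_compact\<close> the limit control is the same for all times
  \<open>t\<close>, positive and negative. Concatenation is required only at times \<open>s
  \<ge> 0\<close>: for \<open>s < 0\<close> the control would be changed before time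
  \<open>0\<close> is reached again, and the trajectory would no longer start at
  \<open>x\<close>.
\<close>
locale control_flow =
  fixes \<phi> :: "real \<Rightarrow> 'a::metric_space \<Rightarrow> 'u \<Rightarrow> 'a" and \<U> :: "'u set"
  assumes initial: "u \<in> \<U> \<Longrightarrow> \<phi> 0 x u = x"
    and shift: "u \<in> \<U> \<Longrightarrow> \<exists>v\<in>\<U>. \<forall>t. \<phi> t (\<phi> s x u) v = \<phi> (s + t) x u"
    and concat: "\<lbrakk>u \<in> \<U>; v \<in> \<U>; 0 \<le> s\<rbrakk> \<Longrightarrow>
      \<exists>w\<in>\<U>. (\<forall>t\<le>s. \<phi> t x w = \<phi> t x u) \<and> (\<forall>t\<ge>0. \<phi> (s + t) x w = \<phi> t (\<phi> s x u) v)"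
    and continuous_initial: "\<lbrakk>u \<in> \<U>; q \<longlonglongrightarrow> y\<rbrakk> \<Longrightarrow> (\<lambda>n. \<phi> t (q n) u) \<longlonglongrightarrow> \<phi> t y u"
    and sequentially_compact: "\<lbrakk>\<And>n. us n \<in> \<U>; q \<longlonglongrightarrow> y\<rbrakk> \<Longrightarrow>
      \<exists>(r :: nat \<Rightarrow> nat) u. strict_mono r \<and> u \<in> \<U> \<and> (\<forall>t. (\<lambda>n. \<phi> t (q (r n)) (us (r n))) \<longlonglongrightarrow> \<phi> t y u)"
begin

definition chain_step :: "real \<Rightarrow> real \<Rightarrow> 'a \<Rightarrow> 'a \<Rightarrow> bool" where
  "chain_step \<epsilon> T x y \<longleftrightarrow> (\<exists>u\<in>\<U>. \<exists>t\<ge>T. dist (\<phi> t x u) y < \<epsilon>)"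

lemma chain_stepI: "\<lbrakk>u \<in> \<U>; t \<ge> T; dist (\<phi> t x u) y < \<epsilon>\<rbrakk> \<Longrightarrow> chain_step \<epsilon> T x y"
  by (auto simp: chain_step_def)

text \<open>
  Chains thereby inherit concatenation and the splitting off of first and last segments from
  transitive closures.
\<close>
lemma controlled_chain_iff_tranclp:
  "controlled_chain \<phi> \<U> \<epsilon> T x y \<longleftrightarrow> (chain_step \<epsilon> T)\<^sup>+\<^sup>+ x y"
proof -
  have "controlled_chain \<phi> \<U> \<epsilon> T x y \<longleftrightarrow>
      (\<exists>k>0. \<exists>xs. xs 0 = x \<and> xs k = y \<and> (\<forall>j<k. chain_step \<epsilon> T (xs j) (xs (Suc j))))"
  proof
    assume "controlled_chain \<phi> \<U> \<epsilon> T x y"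
    then show "\<exists>k>0. \<exists>xs. xs 0 = x \<and> xs k = y \<and> (\<forall>j<k. chain_step \<epsilon> T (xs j) (xs (Suc j)))"
      unfolding controlled_chain_def chain_step_def Suc_le_eq One_nat_def by blast
  next
    assume "\<exists>k>0. \<exists>xs. xs 0 = x \<and> xs k = y \<and> (\<forall>j<k. chain_step \<epsilon> T (xs j) (xs (Suc j)))"
    then obtain k xs where k: "k > 0" "xs 0 = x" "xs k = y" "\<forall>j<k. chain_step \<epsilon> T (xs j) (xs (Suc j))"
      by blast
    have "\<forall>j. \<exists>u t. j < k \<longrightarrow> u \<in> \<U> \<and> t \<ge> T \<and> dist (\<phi> t (xs j) u) (xs (Suc j)) < \<epsilon>"
      using k(4) unfolding chain_step_def by blast
    then obtain us ts where "\<forall>j<k. us j \<in> \<U> \<and> ts j \<ge> T \<and> dist (\<phi> (ts j) (xs j) (us j)) (xs (Suc j)) < \<epsilon>"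
      by metis
    then show "controlled_chain \<phi> \<U> \<epsilon> T x y"
      unfolding controlled_chain_def Suc_le_eq One_nat_def using k by blast
  qed
  then show ?thesis
    by (simp add: tranclp_power relpowp_fun_conv)
qed

lemma chain_controllable_iff:
  "chain_controllable \<phi> \<U> x y \<longleftrightarrow> (\<forall>\<epsilon>>0. \<forall>T>0. (chain_step \<epsilon> T)\<^sup>+\<^sup>+ x y)"
  by (simp add: chain_controllable_def controlled_chain_iff_tranclp)

lemma chain_controllable_trans:
  "\<lbrakk>chain_controllable \<phi> \<U> x y; chain_controllable \<phi> \<U> y z\<rbrakk> \<Longrightarrow> chain_controllable \<phi> \<U> x z"
  unfolding chain_controllable_iff by (meson tranclp_trans)

lemma chain_step_mono: "\<lbrakk>chain_step \<delta> S x y; \<delta> \<le> \<epsilon>; T \<le> S\<rbrakk> \<Longrightarrow> chain_step \<epsilon> T x y"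
  unfolding chain_step_def by (meson less_le_trans order_trans)

lemma rtranclp_chain_step_mono:
  assumes "(chain_step \<delta> S)\<^sup>*\<^sup>* x y" "\<delta> \<le> \<epsilon>" "T \<le> S"
  shows "(chain_step \<epsilon> T)\<^sup>*\<^sup>* x y"
  using assms(1) by (rule rtranclp_mono[THEN predicate2D, rotated]) (use assms in \<open>auto intro: chain_step_mono\<close>)

lemma flow_then_chain_step:
  assumes u: "u \<in> \<U>" and s: "0 \<le> s" and T: "0 < T" and st: "chain_step \<epsilon> T (\<phi> s x u) y"
  shows "chain_step \<epsilon> T x y"
proof -
  obtain v t where v: "v \<in> \<U>" "T \<le> t" "dist (\<phi> t (\<phi> s x u) v) y < \<epsilon>"
    using st by (auto simp: chain_step_def)
  obtain w where "w \<in> \<U>" "\<forall>t\<ge>0. \<phi> (s + t) x w = \<phi> t (\<phi> s x u) v"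
    using concat[OF u v(1) s, of x] by blast
  with v s T show ?thesis by (intro chain_stepI[of w _ "s + t"]) auto
qed

lemma flow_then_chain_controllable:
  assumes "u \<in> \<U>" "0 \<le> s" "chain_controllable \<phi> \<U> (\<phi> s x u) y"
  shows "chain_controllable \<phi> \<U> x y"
  unfolding chain_controllable_iff
proof (intro allI impI)
  fix \<epsilon> T :: real assume "0 < \<epsilon>" "0 < T"
  then have "(chain_step \<epsilon> T)\<^sup>+\<^sup>+ (\<phi> s x u) y"
    using assms(3) unfolding chain_controllable_iff by simp
  from tranclpD[OF this]
  obtain z where z: "chain_step \<epsilon> T (\<phi> s x u) z" "(chain_step \<epsilon> T)\<^sup>*\<^sup>* z y" by blast
  have "chain_step \<epsilon> T x z"
    by (rule flow_then_chain_step[OF assms(1,2) \<open>0 < T\<close> z(1)])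
  then show "(chain_step \<epsilon> T)\<^sup>+\<^sup>+ x y" using z(2) by (rule rtranclp_into_tranclp2)
qed

lemma backward_flow_chain_controllable:
  assumes y: "chain_controllable \<phi> \<U> y x" and u: "u \<in> \<U>" and t: "t < 0"
  shows "chain_controllable \<phi> \<U> (\<phi> t y u) x"
proof -
  obtain v where v: "v \<in> \<U>" "\<forall>s. \<phi> s (\<phi> t y u) v = \<phi> (t + s) y u"
    using shift[OF u] by blast
  then have "\<phi> (- t) (\<phi> t y u) v = y" using initial[OF u] by simp
  then show ?thesis
    using flow_then_chain_controllable[OF v(1), of "- t" "\<phi> t y u" x] y t by simp
qed

text \<open>
  Let \<open>u\<close> be a limit of controls \<open>u\<^sub>n\<close> on the first segments of
  ever finer chains from \<open>y\<close>. From \<open>\<phi>(t, y, u)\<close>, follow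
  \<open>u\<close> for time \<open>T\<close>, jump to \<open>\<phi>(t + T, y,
  u\<^sub>n)\<close>, follow \<open>u\<^sub>n\<close> to the end of its segment and then the
  rest of the chain. The second segment still lasts at least \<open>T\<close> when the whole one
  lasts at least \<open>t + 2 T\<close>.
\<close>
lemma exists_forward_orbit_chain_controllable:
  assumes y: "chain_controllable \<phi> \<U> y x"
  obtains u where "u \<in> \<U>" "\<And>t. 0 < t \<Longrightarrow> chain_controllable \<phi> \<U> (\<phi> t y u) x"
proof -
  have "\<exists>u t z. u \<in> \<U> \<and> real (Suc n) \<le> t \<and> dist (\<phi> t y u) z < 1 / Suc n \<and>
      (chain_step (1 / Suc n) (Suc n))\<^sup>*\<^sup>* z x" for n
  proof -
    have "(chain_step (1 / Suc n) (Suc n))\<^sup>+\<^sup>+ y x"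
      using y unfolding chain_controllable_iff by simp
    from tranclpD[OF this]
    obtain z where "chain_step (1 / Suc n) (Suc n) y z" "(chain_step (1 / Suc n) (Suc n))\<^sup>*\<^sup>* z x" by blast
    then show ?thesis unfolding chain_step_def by blast
  qed
  then obtain us ts zs where us: "\<And>n. us n \<in> \<U>" and ts: "\<And>n. real (Suc n) \<le> ts n"
    and zs: "\<And>n. dist (\<phi> (ts n) y (us n)) (zs n) < 1 / Suc n"
    and ch: "\<And>n. (chain_step (1 / Suc n) (Suc n))\<^sup>*\<^sup>* (zs n) x"
    by metis
  obtain r u where r: "strict_mono (r :: nat \<Rightarrow> nat)" and u: "u \<in> \<U>"
    and lim: "\<And>t. (\<lambda>n. \<phi> t y (us (r n))) \<longlonglongrightarrow> \<phi> t y u"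
    using sequentially_compact[of us "\<lambda>_. y" y] us by auto
  show thesis
  proof (rule that[OF u])
    fix t :: real assume t: "0 < t"
    show "chain_controllable \<phi> \<U> (\<phi> t y u) x"
      unfolding chain_controllable_iff
    proof (intro allI impI)
      fix \<epsilon> T :: real assume \<epsilon>: "0 < \<epsilon>" and T: "0 < T"
      obtain n1 where n1: "\<And>n. n \<ge> n1 \<Longrightarrow> dist (\<phi> (t + T) y (us (r n))) (\<phi> (t + T) y u) < \<epsilon>"
        using lim[of "t + T"] \<epsilon> by (meson lim_sequentially)
      obtain n2 :: nat where n2: "t + 2 * T + 1 / \<epsilon> < n2" using reals_Archimedean2 by blast
      define n where "n = r (max n1 n2)"
      have n2n: "real n2 \<le> Suc n"
        using seq_suble[OF r, of "max n1 n2"] by (simp add: n_def)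
      have "1 / \<epsilon> \<le> Suc n" using n2 n2n t T by linarith
      then have small: "1 / real (Suc n) \<le> \<epsilon>" using \<epsilon> by (simp add: field_simps)
      have time: "t + 2 * T \<le> ts n" and TS: "T \<le> real (Suc n)"
        using n2 n2n ts[of n] t T divide_pos_pos[OF zero_less_one \<epsilon>] by linarith+
      let ?p = "\<phi> (t + T) y (us n)"
      obtain v where v: "v \<in> \<U>" "\<forall>s. \<phi> s (\<phi> t y u) v = \<phi> (t + s) y u" using shift[OF u] by blast
      obtain v' where v': "v' \<in> \<U>" "\<forall>s. \<phi> s ?p v' = \<phi> (t + T + s) y (us n)" using shift[OF us] by blast
      have "chain_step \<epsilon> T (\<phi> t y u) ?p"
        using v n1[of "max n1 n2"] by (intro chain_stepI[of v _ T]) (auto simp: n_def dist_commute)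
      moreover have "chain_step \<epsilon> T ?p (zs n)"
        using v' time zs[of n] small by (intro chain_stepI[of v' _ "ts n - t - T"]) (auto simp: algebra_simps)
      moreover have "(chain_step \<epsilon> T)\<^sup>*\<^sup>* (zs n) x"
        by (rule rtranclp_chain_step_mono[OF ch small TS])
      ultimately show "(chain_step \<epsilon> T)\<^sup>+\<^sup>+ (\<phi> t y u) x"
        by (meson converse_rtranclp_into_rtranclp rtranclp_into_tranclp2)
    qed
  qed
qed

text \<open>
  The endpoints \<open>\<phi>(t\<^sub>n, x\<^sub>n, u\<^sub>n)\<close> of the last segments, not
  their targets, converge to \<open>y\<close>; the trajectories ending there are the ones to be
  prolonged or traced back.
\<close>
lemma chain_controllable_last_segments:
  assumes y: "chain_controllable \<phi> \<U> x y"
  obtains xs us ts where "\<And>n. us n \<in> \<U>" "\<And>n. real (Suc n) \<le> ts n"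
    "\<And>n. (chain_step (1 / Suc n) (Suc n))\<^sup>*\<^sup>* x (xs n)" "(\<lambda>n. \<phi> (ts n) (xs n) (us n)) \<longlonglongrightarrow> y"
proof -
  have "\<exists>u t z. u \<in> \<U> \<and> real (Suc n) \<le> t \<and> dist (\<phi> t z u) y < 1 / Suc n \<and>
      (chain_step (1 / Suc n) (Suc n))\<^sup>*\<^sup>* x z" for n
  proof -
    have "(chain_step (1 / Suc n) (Suc n))\<^sup>+\<^sup>+ x y"
      using y unfolding chain_controllable_iff by simp
    then obtain z where "(chain_step (1 / Suc n) (Suc n))\<^sup>*\<^sup>* x z" "chain_step (1 / Suc n) (Suc n) z y"
      by (metis tranclp.cases rtranclp.rtrancl_refl tranclp_into_rtranclp)
    then show ?thesis unfolding chain_step_def by blast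
  qed
  then obtain us ts xs where *: "\<And>n. us n \<in> \<U>" "\<And>n. real (Suc n) \<le> ts n"
    "\<And>n. (chain_step (1 / Suc n) (Suc n))\<^sup>*\<^sup>* x (xs n)"
    and near: "\<And>n. dist (\<phi> (ts n) (xs n) (us n)) y < 1 / Suc n"
    by metis
  have "(\<lambda>n. \<phi> (ts n) (xs n) (us n)) \<longlonglongrightarrow> y"
  proof (rule metric_tendsto_imp_tendsto[OF LIMSEQ_inverse_real_of_nat])
    show "\<forall>\<^sub>F n in sequentially. dist (\<phi> (ts n) (xs n) (us n)) y \<le> dist (inverse (real (Suc n))) 0"
      using near by (intro always_eventually allI) (simp add: inverse_eq_divide less_imp_le)
  qed
  then show thesis using that * by blast
qed

text \<open>
  Stopping the last segments at a bounded time offset \<open>t\<close>, before or after their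
  end, keeps them long, so limits of such points are again chain reachable.
\<close>
lemma chain_controllable_if_steps:
  assumes ch: "\<And>n. (chain_step (1 / Suc n) (Suc n))\<^sup>*\<^sup>* x (xs n)" and r: "strict_mono (r :: nat \<Rightarrow> nat)"
    and us: "\<And>n. us n \<in> \<U>" and ts: "\<And>n. real (Suc n) \<le> ts n"
    and lim: "(\<lambda>n. \<phi> (ts (r n) + t) (xs (r n)) (us (r n))) \<longlonglongrightarrow> z"
  shows "chain_controllable \<phi> \<U> x z"
  unfolding chain_controllable_iff
proof (intro allI impI)
  fix \<epsilon> T :: real assume \<epsilon>: "0 < \<epsilon>" and T: "0 < T"
  obtain n1 where n1: "\<And>n. n \<ge> n1 \<Longrightarrow> dist (\<phi> (ts (r n) + t) (xs (r n)) (us (r n))) z < \<epsilon>"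
    using lim \<epsilon> by (meson lim_sequentially)
  obtain n2 :: nat where n2: "\<bar>t\<bar> + T + 1 / \<epsilon> < n2" using reals_Archimedean2 by blast
  define n where "n = r (max n1 n2)"
  have n2n: "real n2 \<le> Suc n"
    using seq_suble[OF r, of "max n1 n2"] by (simp add: n_def)
  have "1 / \<epsilon> \<le> Suc n" using n2 n2n T by linarith
  then have small: "1 / real (Suc n) \<le> \<epsilon>" using \<epsilon> by (simp add: field_simps)
  have time: "T \<le> ts n + t" and TS: "T \<le> real (Suc n)"
    using n2 n2n ts[of n] T divide_pos_pos[OF zero_less_one \<epsilon>] by linarith+
  have "(chain_step \<epsilon> T)\<^sup>*\<^sup>* x (xs n)"
    by (rule rtranclp_chain_step_mono[OF ch small TS])
  moreover have "chain_step \<epsilon> T (xs n) z"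
    using n1[of "max n1 n2"] by (intro chain_stepI[OF us time]) (simp add: n_def)
  ultimately show "(chain_step \<epsilon> T)\<^sup>+\<^sup>+ x z" by (rule rtranclp_into_tranclp1)
qed

text \<open>
  Prolong the last segment by the flow for time \<open>t\<close>; continuity in the initial
  state turns the small last jump before \<open>y\<close> into a small jump at \<open>\<phi>(t,
  y, v)\<close>.
\<close>
lemma forward_flow_chain_reachable:
  assumes y: "chain_controllable \<phi> \<U> x y" and v: "v \<in> \<U>" and t: "0 < t"
  shows "chain_controllable \<phi> \<U> x (\<phi> t y v)"
proof -
  obtain xs us ts where us: "\<And>n. us n \<in> \<U>" and ts: "\<And>n. real (Suc n) \<le> ts n"
    and ch: "\<And>n. (chain_step (1 / Suc n) (Suc n))\<^sup>*\<^sup>* x (xs n)"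
    and lim: "(\<lambda>n. \<phi> (ts n) (xs n) (us n)) \<longlonglongrightarrow> y"
    by (rule chain_controllable_last_segments[OF y]) (rule that)
  have "\<exists>w\<in>\<U>. \<phi> (ts n + t) (xs n) w = \<phi> t (\<phi> (ts n) (xs n) (us n)) v" for n
  proof -
    have "0 \<le> ts n" using ts[of n] by linarith
    from concat[OF us v this, of "xs n"] show ?thesis using t by (meson less_imp_le)
  qed
  then obtain ws where ws: "\<And>n. ws n \<in> \<U>"
    and eq: "\<And>n. \<phi> (ts n + t) (xs n) (ws n) = \<phi> t (\<phi> (ts n) (xs n) (us n)) v" by metis
  have "(\<lambda>n. \<phi> (ts (id n) + t) (xs (id n)) (ws (id n))) \<longlonglongrightarrow> \<phi> t y v"
    using continuous_initial[OF v lim] by (simp add: eq)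
  then show ?thesis
    by (rule chain_controllable_if_steps[where r = id, OF ch strict_mono_id ws ts])
qed

text \<open>
  The last segments are run backwards from their endpoints, which converge to \<open>y\<close>;
  here sequential compactness is needed with varying initial states.
\<close>
lemma exists_backward_orbit_chain_reachable:
  assumes y: "chain_controllable \<phi> \<U> x y"
  obtains v where "v \<in> \<U>" "\<And>t. t < 0 \<Longrightarrow> chain_controllable \<phi> \<U> x (\<phi> t y v)"
proof -
  obtain xs us ts where us: "\<And>n. us n \<in> \<U>" and ts: "\<And>n. real (Suc n) \<le> ts n"
    and ch: "\<And>n. (chain_step (1 / Suc n) (Suc n))\<^sup>*\<^sup>* x (xs n)"
    and lim: "(\<lambda>n. \<phi> (ts n) (xs n) (us n)) \<longlonglongrightarrow> y"
    by (rule chain_controllable_last_segments[OF y]) (rule that)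
  have "\<exists>w\<in>\<U>. \<forall>t. \<phi> t (\<phi> (ts n) (xs n) (us n)) w = \<phi> (ts n + t) (xs n) (us n)" for n
    by (rule shift[OF us])
  then obtain ws where ws: "\<And>n. ws n \<in> \<U>"
    and eq: "\<And>n t. \<phi> t (\<phi> (ts n) (xs n) (us n)) (ws n) = \<phi> (ts n + t) (xs n) (us n)" by metis
  obtain r v where r: "strict_mono (r :: nat \<Rightarrow> nat)" and v: "v \<in> \<U>"
    and conv: "\<And>t. (\<lambda>n. \<phi> (ts (r n) + t) (xs (r n)) (us (r n))) \<longlonglongrightarrow> \<phi> t y v"
    using sequentially_compact[of ws, OF ws lim] unfolding eq by blast
  show thesis
    by (rule that[OF v]) (rule chain_controllable_if_steps[OF ch r us ts conv])
qed

lemma chain_control_set_eq: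
  assumes E: "chain_control_set \<phi> \<U> E" and z: "z \<in> E"
  shows "E = chain_reachable_set \<phi> \<U> z \<inter> chain_controllable_set \<phi> \<U> z"
proof -
  let ?F = "chain_reachable_set \<phi> \<U> z \<inter> chain_controllable_set \<phi> \<U> z"
  have "E \<subseteq> ?F"
    using E z by (auto simp: chain_control_set_def chain_reachable_set_def chain_controllable_set_def)
  moreover have "\<forall>x\<in>?F. \<forall>y\<in>?F. chain_controllable \<phi> \<U> x y"
    by (auto simp: chain_reachable_set_def chain_controllable_set_def intro: chain_controllable_trans)
  ultimately show ?thesis using E unfolding chain_control_set_def by metis
qed

text \<open>
  On each half line one membership comes from the choice of the control and the other from
  invariance, which holds for every control.
\<close>
lemma exists_orbit_in_chain_control_set:
  assumes E: "chain_control_set \<phi> \<U> E" and z: "z \<in> E"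
  obtains u where "u \<in> \<U>" "\<And>t. \<phi> t z u \<in> E"
proof -
  have zz: "chain_controllable \<phi> \<U> z z" using E z by (auto simp: chain_control_set_def)
  have inE: "p \<in> E" if "chain_controllable \<phi> \<U> z p" "chain_controllable \<phi> \<U> p z" for p
    using chain_control_set_eq[OF E z] that by (auto simp: chain_reachable_set_def chain_controllable_set_def)
  obtain v where v: "v \<in> \<U>" "\<And>t. t < 0 \<Longrightarrow> chain_controllable \<phi> \<U> z (\<phi> t z v)"
    using exists_backward_orbit_chain_reachable[OF zz] by blast
  obtain u where u: "u \<in> \<U>" "\<And>t. 0 < t \<Longrightarrow> chain_controllable \<phi> \<U> (\<phi> t z u) z"
    using exists_forward_orbit_chain_controllable[OF zz] by blast
  obtain w where w: "w \<in> \<U>" "\<And>t. t \<le> 0 \<Longrightarrow> \<phi> t z w = \<phi> t z v" "\<And>t. 0 \<le> t \<Longrightarrow> \<phi> t z w = \<phi> t z u"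
    using concat[OF v(1) u(1) order_refl, of z] initial[OF v(1)] by auto
  have "\<phi> t z w \<in> E" for t
  proof (cases t "0 :: real" rule: linorder_cases)
    case less
    then show ?thesis
      using inE[of "\<phi> t z v"] v(2)[OF less] backward_flow_chain_controllable[OF zz v(1) less] w(2) by simp
  next
    case equal
    then show ?thesis using initial[OF w(1)] z by simp
  next
    case greater
    then show ?thesis
      using inE[of "\<phi> t z u"] u(2)[OF greater] forward_flow_chain_reachable[OF zz u(1) greater] w(3) by simp
  qed
  with w(1) show thesis by (rule that)
qed

end

section \<open>The control flow of a control-affine system\<close>

locale control_affine_flow = control_affine_system A X\<^sub>0 X U
  for A :: "('a::metric_space, 'e::euclidean_space) chart set"
    and X\<^sub>0 :: "('a, 'e) vector_field"
    and X :: "'m::finite \<Rightarrow> ('a, 'e) vector_field"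
    and U :: "(real ^ 'm) set" +
  assumes unique: "unique_global_solutions A X\<^sub>0 X U"
begin

abbreviation "\<U> \<equiv> admissible_controls U"
abbreviation "\<phi> \<equiv> solution_map A X\<^sub>0 X"

lemma solution_map_solution:
  assumes "u \<in> \<U>"
  shows "sol u (\<lambda>t. \<phi> t x u)" "\<phi> 0 x u = x"
proof -
  have "\<exists>!\<xi>. sol u \<xi> \<and> \<xi> 0 = x"
    using unique assms by (simp add: unique_global_solutions_def)
  from theI'[OF this] show "sol u (\<lambda>t. \<phi> t x u)" "\<phi> 0 x u = x"
    by (simp_all add: solution_map_def)
qed

lemma solution_map_eqI:
  assumes u: "u \<in> \<U>" and \<xi>: "sol u \<xi>"
  shows "\<phi> t (\<xi> 0) u = \<xi> t"
proof -
  have "\<exists>!\<zeta>. sol u \<zeta> \<and> \<zeta> 0 = \<xi> 0"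
    using unique u by (simp add: unique_global_solutions_def)
  then have "(THE \<zeta>. sol u \<zeta> \<and> \<zeta> 0 = \<xi> 0) = \<xi>"
    using \<xi> by (intro the1_equality) auto
  then show ?thesis by (simp add: solution_map_def)
qed

lemma admissibleI:
  assumes "u \<in> borel_measurable lebesgue" "\<And>t. u t \<in> U"
  shows "u \<in> \<U>"
proof -
  obtain C where "\<And>w. w \<in> U \<Longrightarrow> norm w \<le> C"
    using compact_imp_bounded[OF compact_controls] by (auto simp: bounded_iff)
  then have "\<forall>t. norm (u t) \<le> C" using assms(2) by blast
  then show ?thesis
    using assms by (auto simp: admissible_controls_def L_infinity_def)
qed

lemma solution_map_cong_AE:
  assumes u: "u \<in> \<U>" and v: "v \<in> \<U>" and uv: "AE t in lebesgue. u t = v t"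
  shows "\<phi> t x u = \<phi> t x v"
  using solution_map_eqI[OF v solution_cong_AE[OF solution_map_solution(1)[OF u] uv], of t x]
    solution_map_solution(2)[OF u] by simp

text \<open>
  Changing a control on a null set alters no solution; the value 0 on the exceptional set lies
  in \<open>U\<close>.
\<close>
lemma U_valued_representative:
  assumes u: "u \<in> \<U>"
  obtains v where "v \<in> \<U>" "v \<in> borel_measurable lebesgue" "\<And>t. v t \<in> U"
    "\<And>t x. \<phi> t x v = \<phi> t x u"
proof -
  define v where "v t = (if u t \<in> U then u t else 0)" for t
  have um: "u \<in> borel_measurable lebesgue" and uU: "AE t in lebesgue. u t \<in> U"
    using u by (auto simp: admissible_controls_def L_infinity_def)
  have [measurable]: "U \<in> sets borel" using compact_controls by (simp add: borel_compact)
  have vm: "v \<in> borel_measurable lebesgue"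
    unfolding v_def[abs_def] using um by measurable
  have vU: "v t \<in> U" for t using zero_control by (simp add: v_def)
  have v: "v \<in> \<U>" by (rule admissibleI[OF vm vU])
  have "AE t in lebesgue. v t = u t" using uU by eventually_elim (simp add: v_def)
  then have "\<phi> t x v = \<phi> t x u" for t x by (rule solution_map_cong_AE[OF v u])
  then show thesis using that v vm vU by blast
qed

sublocale control_flow \<phi> \<U>
proof
  fix u x assume "u \<in> \<U>"
  then show "\<phi> 0 x u = x" by (rule solution_map_solution(2))
next
  fix u s x assume "u \<in> \<U>"
  then obtain u' where u': "u' \<in> \<U>" "u' \<in> borel_measurable lebesgue" "\<And>t. u' t \<in> U"
    and eq: "\<And>t x. \<phi> t x u' = \<phi> t x u" by (rule U_valued_representative) (rule that)
  have v: "(\<lambda>t. u' (t + s)) \<in> \<U>"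
    by (rule admissibleI[OF lebesgue_measurable_translate[OF u'(2)] u'(3)])
  have "sol (\<lambda>t. u' (t + s)) (\<lambda>t. \<phi> (t + s) x u')"
    using solution_shift[OF solution_map_solution(1)[OF u'(1)] u'(3)] .
  from solution_map_eqI[OF v this]
  have "\<forall>t. \<phi> t (\<phi> s x u) (\<lambda>t. u' (t + s)) = \<phi> (s + t) x u"
    by (simp add: eq add.commute)
  with v show "\<exists>v\<in>\<U>. \<forall>t. \<phi> t (\<phi> s x u) v = \<phi> (s + t) x u" by blast
next
  fix u v and s :: real and x assume "u \<in> \<U>" "v \<in> \<U>" and s: "0 \<le> s"
  obtain u' where u': "u' \<in> \<U>" "u' \<in> borel_measurable lebesgue" "\<And>t. u' t \<in> U"
    and equ: "\<And>t x. \<phi> t x u' = \<phi> t x u" by (rule U_valued_representative[OF \<open>u \<in> \<U>\<close>]) (rule that)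
  obtain v' where v': "v' \<in> \<U>" "v' \<in> borel_measurable lebesgue" "\<And>t. v' t \<in> U"
    and eqv: "\<And>t x. \<phi> t x v' = \<phi> t x v" by (rule U_valued_representative[OF \<open>v \<in> \<U>\<close>]) (rule that)
  let ?y = "\<phi> s x u'"
  let ?w = "\<lambda>t. if t \<le> s then u' t else v' (t + - s)"
    and ?\<chi> = "\<lambda>t. if t \<le> s then \<phi> t x u' else \<phi> (t + - s) ?y v'"
  have "?w \<in> borel_measurable lebesgue"
  proof (rule measurable_If[OF u'(2) lebesgue_measurable_translate[OF v'(2)]])
    show "{t \<in> space lebesgue. t \<le> s} \<in> sets lebesgue"
      by (simp flip: atMost_def)
  qed
  then have w: "?w \<in> \<U>" by (rule admissibleI) (simp add: u'(3) v'(3))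
  have "sol ?w ?\<chi>"
    using solution_map_solution(2)[OF v'(1), of ?y]
    by (intro solution_concat solution_shift solution_map_solution(1) u' v') simp
  from solution_map_eqI[OF w this] have \<chi>: "\<phi> t x ?w = ?\<chi> t" for t
    using s solution_map_solution(2)[OF u'(1)] by simp
  have "\<phi> (s + t) x ?w = \<phi> t (\<phi> s x u) v" if "0 \<le> t" for t
    using that \<chi>[of "s + t"] solution_map_solution(2)[OF v'(1), of ?y] by (auto simp: equ eqv)
  moreover have "\<phi> t x ?w = \<phi> t x u" if "t \<le> s" for t
    using that \<chi>[of t] by (simp add: equ)
  ultimately show "\<exists>w\<in>\<U>. (\<forall>t\<le>s. \<phi> t x w = \<phi> t x u) \<and> (\<forall>t\<ge>0. \<phi> (s + t) x w = \<phi> t (\<phi> s x u) v)"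
    using w by blast
next
  fix u and q :: "nat \<Rightarrow> 'a" and y t assume u: "u \<in> \<U>" and q: "q \<longlonglongrightarrow> y"
  obtain u' where u': "u' \<in> \<U>" "u' \<in> borel_measurable lebesgue" "\<And>t. u' t \<in> U"
    and eq: "\<And>t x. \<phi> t x u' = \<phi> t x u" by (rule U_valued_representative[OF u]) (rule that)
  have "(\<lambda>n. \<phi> t (q n) u') \<longlonglongrightarrow> \<phi> t y u'"
    by (rule solutions_converge[where us = "\<lambda>n. u'" and \<xi> = "\<lambda>t. \<phi> t y u'" and s = 0])
      (use u' q solution_map_solution[OF u'(1)] in auto)
  then show "(\<lambda>n. \<phi> t (q n) u) \<longlonglongrightarrow> \<phi> t y u" by (simp add: eq)
next
  fix us :: "nat \<Rightarrow> real \<Rightarrow> real ^ 'm" and q :: "nat \<Rightarrow> 'a" and y assume us: "\<And>n. us n \<in> \<U>" and q: "q \<longlonglongrightarrow> y"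
  have "\<exists>v. v \<in> \<U> \<and> v \<in> borel_measurable lebesgue \<and> (\<forall>t. v t \<in> U) \<and> (\<forall>t x. \<phi> t x v = \<phi> t x (us n))" for n
    by (rule U_valued_representative[OF us[of n]]) blast
  then obtain vs where vs: "\<And>n. vs n \<in> \<U>" "\<And>n. vs n \<in> borel_measurable lebesgue" "\<And>n t. vs n t \<in> U"
    and eq: "\<And>n t x. \<phi> t x (vs n) = \<phi> t x (us n)" by metis
  obtain r v where r: "strict_mono (r :: nat \<Rightarrow> nat)" and v: "v \<in> borel_measurable lebesgue" "\<And>t. v t \<in> U"
    and weak: "\<And>a b. (\<lambda>n. integral {a..b} (vs (r n))) \<longlonglongrightarrow> integral {a..b} v"
    by (rule weak_sequential_compactness[OF compact_controls convex_controls vs(2,3)]) (rule that)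
  have v\<U>: "v \<in> \<U>" by (rule admissibleI[OF v])
  have "(\<lambda>n. \<phi> t (q (r n)) (vs (r n))) \<longlonglongrightarrow> \<phi> t y v" for t
  proof (rule solutions_converge[where us = "\<lambda>n. vs (r n)" and \<xi> = "\<lambda>t. \<phi> t y v" and s = 0])
    show "(\<lambda>n. \<phi> 0 (q (r n)) (vs (r n))) \<longlonglongrightarrow> \<phi> 0 y v"
      using LIMSEQ_subseq_LIMSEQ[OF q r] solution_map_solution(2)[OF vs(1)] solution_map_solution(2)[OF v\<U>]
      by (simp add: o_def)
  qed (use vs v weak solution_map_solution(1)[OF vs(1)] solution_map_solution(1)[OF v\<U>] in auto)
  then show "\<exists>(r :: nat \<Rightarrow> nat) u. strict_mono r \<and> u \<in> \<U> \<and> (\<forall>t. (\<lambda>n. \<phi> t (q (r n)) (us (r n))) \<longlonglongrightarrow> \<phi> t y u)"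
    using r v\<U> by (auto simp: eq)
qed

end

theorem theorem2p14:
  fixes A :: "('a::{metric_space, second_countable_topology}, 'e::euclidean_space) chart set"
    and X\<^sub>0 :: "('a, 'e) vector_field"
    and X :: "'m::finite \<Rightarrow> ('a, 'e) vector_field"
    and U :: "(real ^ 'm) set"
    and \<U> :: "(real \<Rightarrow> real ^ 'm) set"
    and \<phi> :: "real \<Rightarrow> 'a \<Rightarrow> (real \<Rightarrow> real ^ 'm) \<Rightarrow> 'a"
    and x :: 'a
  assumes "smooth_atlas A"
    and "smooth_vector_field A X\<^sub>0"
    and "\<And>i. smooth_vector_field A (X i)"
    and "compact U" and "convex U" and "0 \<in> interior U"
    and "unique_global_solutions A X\<^sub>0 X U"
    and "\<U> = admissible_controls U"
    and "\<phi> = solution_map A X\<^sub>0 X"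
  shows
    "((\<forall>y\<in>chain_controllable_set \<phi> \<U> x. \<forall>u\<in>\<U>. \<forall>t<0. \<phi> t y u \<in> chain_controllable_set \<phi> \<U> x) \<and>
      (\<forall>y\<in>chain_controllable_set \<phi> \<U> x. \<exists>u\<in>\<U>. \<forall>t>0. \<phi> t y u \<in> chain_controllable_set \<phi> \<U> x)) \<and>
     ((\<forall>y\<in>chain_reachable_set \<phi> \<U> x. \<forall>v\<in>\<U>. \<forall>t>0. \<phi> t y v \<in> chain_reachable_set \<phi> \<U> x) \<and>
      (\<forall>y\<in>chain_reachable_set \<phi> \<U> x. \<exists>v\<in>\<U>. \<forall>t<0. \<phi> t y v \<in> chain_reachable_set \<phi> \<U> x)) \<and>
     (\<forall>E. chain_control_set \<phi> \<U> E \<longrightarrow>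
       (\<forall>z\<in>E. E = chain_reachable_set \<phi> \<U> z \<inter> chain_controllable_set \<phi> \<U> z \<and>
              (\<exists>u\<in>\<U>. \<forall>t. \<phi> t z u \<in> E)))"
proof -
  interpret S: control_affine_flow A X\<^sub>0 X U
    using assms(1-7) interior_subset by unfold_locales auto
  note eqs = assms(8,9)
  show ?thesis
    unfolding eqs
  proof (intro conjI ballI allI impI)
    fix y u and t :: real
    assume "y \<in> chain_controllable_set S.\<phi> S.\<U> x" "u \<in> S.\<U>" "t < 0"
    then show "S.\<phi> t y u \<in> chain_controllable_set S.\<phi> S.\<U> x"
      by (simp add: chain_controllable_set_def S.backward_flow_chain_controllable)
  next
    fix y assume "y \<in> chain_controllable_set S.\<phi> S.\<U> x"
    then obtain u where "u \<in> S.\<U>" "\<And>t. 0 < t \<Longrightarrow> chain_controllable S.\<phi> S.\<U> (S.\<phi> t y u) x"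
      by (auto simp: chain_controllable_set_def intro: S.exists_forward_orbit_chain_controllable)
    then show "\<exists>u\<in>S.\<U>. \<forall>t>0. S.\<phi> t y u \<in> chain_controllable_set S.\<phi> S.\<U> x"
      by (auto simp: chain_controllable_set_def)
  next
    fix y v and t :: real
    assume "y \<in> chain_reachable_set S.\<phi> S.\<U> x" "v \<in> S.\<U>" "0 < t"
    then show "S.\<phi> t y v \<in> chain_reachable_set S.\<phi> S.\<U> x"
      by (simp add: chain_reachable_set_def S.forward_flow_chain_reachable)
  next
    fix y assume "y \<in> chain_reachable_set S.\<phi> S.\<U> x"
    then obtain v where "v \<in> S.\<U>" "\<And>t. t < 0 \<Longrightarrow> chain_controllable S.\<phi> S.\<U> x (S.\<phi> t y v)"
      by (auto simp: chain_reachable_set_def intro: S.exists_backward_orbit_chain_reachable)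
    then show "\<exists>v\<in>S.\<U>. \<forall>t<0. S.\<phi> t y v \<in> chain_reachable_set S.\<phi> S.\<U> x"
      by (auto simp: chain_reachable_set_def)
  next
    fix E z assume E: "chain_control_set S.\<phi> S.\<U> E" "z \<in> E"
    show "E = chain_reachable_set S.\<phi> S.\<U> z \<inter> chain_controllable_set S.\<phi> S.\<U> z"
      by (rule S.chain_control_set_eq[OF E])
    show "\<exists>u\<in>S.\<U>. \<forall>t. S.\<phi> t z u \<in> E"
      using S.exists_orbit_in_chain_control_set[OF E] by blast
  qed
qed

end
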